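(* For every $\varepsilon>0$ and integer $m\ge1$ there is a $\delta=\delta(\varepsilon,m)>0$ such that for every $n>n(\varepsilon,\delta,m)$ the following holds: if $\mu,\nu\in\mathcal{P}([0,1])$ and $$H_n(\mu*\nu)<H_n(\mu)+\delta,$$ then there are disjoint subsets $I,J\subseteq\{1,\ldots,n\}$ with $|I\cup J|>(1-\varepsilon)n$ such that $$\mathbb{P}_{i=k}\left(\mu^{x,i}\text{ is }(\varepsilon,m)\text{-uniform}\right)>1-\varepsilon\quad\text{for }k\in I,$$ $$\mathbb{P}_{i=k}\left(\nu^{x,i}\text{ is }\varepsilon\text{-atomic}\right)>1-\varepsilon\quad\text{for }k\in J.$$
   Context: $\mathcal{P}(X)$ is the set of Borel probability measures on $X$. $\mathcal{D}_n=\{[k2^{-n},(k+1)2^{-n}):k\in\mathbb{Z}\}$; $\mathcal{D}_n(x)$ is the cell containing $x$. $H(\mu,\mathcal{D}_n)=-\sum_{D\in\mathcal{D}_n}\mu(D)\log\mu(D)$ (base 2), and $H_n(\mu)=\frac1nH(\mu,\mathcal{D}_n)$. For a cell $D\in\mathcal{D}_n$ let $T_D$ be the orientation-preserving affine map taking $D$ onto $[0,1)$. If $\mu(\mathcal{D}_n(x))>0$, with $D=\mathcal{D}_n(x)$, the rescaled component is $\mu^{x,n}=\frac1{\mu(D)}T_D(\mu|_D)$ (push-forward), a probability measure on $[0,1)$. $\mathbb{P}_{i=k}(\mu^{x,i}\in\mathcal{A})=\mu(\{x:\mu^{x,k}\in\mathcal{A}\})$, i.e. $x$ is chosen according to $\mu$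 (and for components $\nu^{x,i}$ of $\nu$, according to $\nu$). A measure $\theta\in\mathcal{P}([0,1])$ is $\varepsilon$-atomic if there is an interval $I$ of length $\varepsilon$ with $\theta(I)>1-\varepsilon$; it is $(\varepsilon,m)$-uniform if $H_m(\theta)>1-\varepsilon$. "For every $n>n(\varepsilon,\delta,m)$" means: there is a threshold depending only on $\varepsilon,\delta,m$ such that the assertion holds for all larger $n$. *)

theory Defs
  imports "HOL-Probability.Probability"
begin

definition borel_probs :: "real set \<Rightarrow> real measure set" where
  "borel_probs X = {\<mu>. real_distribution \<mu> \<and> measure \<mu> X = 1}"

definition dyadic_cell :: "nat \<Rightarrow> int \<Rightarrow> real set" where
  "dyadic_cell n k = {of_int k / 2 ^ n ..< (of_int k + 1) / 2 ^ n}"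

definition dyadic_partition :: "nat \<Rightarrow> real set set" where
  "dyadic_partition n = range (dyadic_cell n)"

definition dyadic_index :: "nat \<Rightarrow> real \<Rightarrow> int" where
  "dyadic_index n x = \<lfloor>2 ^ n * x\<rfloor>"

definition dyadic_cell_at :: "nat \<Rightarrow> real \<Rightarrow> real set" where
  "dyadic_cell_at n x = dyadic_cell n (dyadic_index n x)"

lemma mem_dyadic_cell_iff: "x \<in> dyadic_cell n k \<longleftrightarrow> dyadic_index n x = k"
proof -
  have "x \<in> dyadic_cell n k \<longleftrightarrow> of_int k \<le> 2 ^ n * x \<and> 2 ^ n * x < of_int k + 1"
    by (simp add: dyadic_cell_def field_simps)
  also have "\<dots> \<longleftrightarrow> dyadic_index n x = k"
    unfolding dyadic_index_def by (auto simp: floor_eq_iff)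
  finally show ?thesis .
qed

lemma dyadic_cell_at_unique:
  "D \<in> dyadic_partition n \<and> x \<in> D \<longleftrightarrow> D = dyadic_cell_at n x"
  by (auto simp: dyadic_partition_def dyadic_cell_at_def mem_dyadic_cell_iff)

text \<open>The affine map \<open>T\<^sub>D\<close> for the cell \<open>D = dyadic_cell n k\<close>.\<close>

definition dyadic_rescale :: "nat \<Rightarrow> int \<Rightarrow> real \<Rightarrow> real" where
  "dyadic_rescale n k y = 2 ^ n * y - of_int k"

lemma dyadic_rescale_image: "dyadic_rescale n k ` dyadic_cell n k = {0..<1}"
proof (intro equalityI subsetI)
  fix z assume "z \<in> dyadic_rescale n k ` dyadic_cell n k"
  then show "z \<in> {0..<1}"
    by (auto simp: dyadic_rescale_def dyadic_cell_def field_simps)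
next
  fix z :: real assume "z \<in> {0..<1}"
  then have "(z + of_int k) / 2 ^ n \<in> dyadic_cell n k"
    and "z = dyadic_rescale n k ((z + of_int k) / 2 ^ n)"
    by (auto simp: dyadic_rescale_def dyadic_cell_def divide_right_mono divide_strict_right_mono)
  then show "z \<in> dyadic_rescale n k ` dyadic_cell n k" by blast
qed

text \<open>The sum over all cells is finite for boundedly supported measures, which are the only
  ones it is applied to; the library convention \<open>log 2 0 = 0\<close> covers cells of measure zero.\<close>

definition dyadic_entropy :: "nat \<Rightarrow> real measure \<Rightarrow> real" where
  "dyadic_entropy n \<mu> =
     - (\<Sum>\<^sub>\<infinity>D\<in>dyadic_partition n. measure \<mu> D * log 2 (measure \<mu> D))"

definition norm_dyadic_entropy :: "nat \<Rightarrow> real measure \<Rightarrow> real" where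
  "norm_dyadic_entropy n \<mu> = dyadic_entropy n \<mu> / real n"

text \<open>The rescaled component \<open>\<mu>\<^sup>x\<^sup>,\<^sup>n\<close>; meaningful only if the cell containing \<open>x\<close> has positive
  measure. Here \<^const>\<open>uniform_measure\<close> restricts \<open>\<mu>\<close> to the cell and normalises.\<close>

definition rescaled_component :: "real measure \<Rightarrow> real \<Rightarrow> nat \<Rightarrow> real measure" where
  "rescaled_component \<mu> x n =
     distr (uniform_measure \<mu> (dyadic_cell_at n x)) borel (dyadic_rescale n (dyadic_index n x))"

text \<open>The set below is a countable union of cells, hence Borel, for every predicate \<open>P\<close>; the points
  excluded because their component is undefined form a null set.\<close>

definition component_prob :: "real measure \<Rightarrow> nat \<Rightarrow> (real measure \<Rightarrow> bool) \<Rightarrow> real" where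
  "component_prob \<mu> k P =
     measure \<mu> {x \<in> space \<mu>. measure \<mu> (dyadic_cell_at k x) > 0 \<and> P (rescaled_component \<mu> x k)}"

definition eps_atomic :: "real \<Rightarrow> real measure \<Rightarrow> bool" where
  "eps_atomic \<epsilon> \<theta> \<longleftrightarrow>
     (\<exists>I. is_interval I \<and> emeasure lborel I = ennreal \<epsilon> \<and> measure \<theta> I > 1 - \<epsilon>)"

definition eps_uniform :: "real \<Rightarrow> nat \<Rightarrow> real measure \<Rightarrow> bool" where
  "eps_uniform \<epsilon> m \<theta> \<longleftrightarrow> norm_dyadic_entropy m \<theta> > 1 - \<epsilon>"

end

theory Submission
  imports Defs
begin

text \<open>Everything is transferred to the integer variables \<open>X = \<lfloor>2\<^sup>n x\<rfloor>\<close> and \<open>Y = \<lfloor>2\<^sup>n y\<rfloor>\<close>; writing \<open>h(r)\<close> for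
  the entropy of \<open>X div 2\<^sup>r\<close>, the entropies of the components of \<open>\<mu>\<close> at level \<open>n - r\<close> are governed by the
  deficits \<open>1 - (h(j) - h(j + 1))\<close> for \<open>j\<close> just below \<open>r\<close>. By the Kaimanovich-Vershik inequality, adding
  \<open>k = 4\<^sup>s\<close> independent copies of \<open>Y\<close> to \<open>X\<close> raises the entropy by at most \<open>k\<close> times the small increment
  caused by one copy. If the conditional variance of \<open>Y\<close> given \<open>Y div 2\<^sup>r\<close> is not small, a characteristic
  function estimate spreads the sum of the copies evenly over about \<open>2\<^sup>s\<close> cells of size \<open>2\<^sup>r\<close>, so that the
  entropy between the scales \<open>r\<close> and \<open>r + s\<close> is \<open>s\<close> up to a constant. Covering all such \<open>r\<close> by disjoint
  windows of length \<open>s\<close> shows that \<open>X\<close> itself has small total deficit on the windows, which makes the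
  components of \<open>\<mu>\<close> uniform there; at the remaining scales the components of \<open>\<nu>\<close> are atomic by
  Chebyshev's inequality.\<close>

section \<open>Entropy of finitely supported distributions\<close>

lemma expectation_finite:
  fixes f :: "'a \<Rightarrow> real"
  assumes "finite (set_pmf p)"
  shows "measure_pmf.expectation p f = (\<Sum>x\<in>set_pmf p. pmf p x * f x)"
  by (subst integral_measure_pmf[OF assms]) auto

lemma expectation_mono_finite:
  fixes f g :: "'a \<Rightarrow> real"
  assumes "finite (set_pmf p)" "\<And>x. x \<in> set_pmf p \<Longrightarrow> f x \<le> g x"
  shows "measure_pmf.expectation p f \<le> measure_pmf.expectation p g"
  by (intro integral_mono_AE integrable_measure_pmf_finite assms(1))
    (simp add: AE_measure_pmf_iff assms(2))

lemma expectation_cong: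
  fixes f g :: "'a \<Rightarrow> real"
  assumes "\<And>x. x \<in> set_pmf p \<Longrightarrow> f x = g x"
  shows "measure_pmf.expectation p f = measure_pmf.expectation p g"
  by (intro integral_cong_AE) (simp_all add: AE_measure_pmf_iff assms)

lemma expectation_add_finite:
  fixes f g :: "'a \<Rightarrow> real"
  assumes "finite (set_pmf p)"
  shows "measure_pmf.expectation p (\<lambda>x. f x + g x) = measure_pmf.expectation p f + measure_pmf.expectation p g"
  by (intro Bochner_Integration.integral_add integrable_measure_pmf_finite assms)

lemma expectation_diff_finite:
  fixes f g :: "'a \<Rightarrow> real"
  assumes "finite (set_pmf p)"
  shows "measure_pmf.expectation p (\<lambda>x. f x - g x) = measure_pmf.expectation p f - measure_pmf.expectation p g"
  by (intro Bochner_Integration.integral_diff integrable_measure_pmf_finite assms)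

lemma expectation_bind_finite:
  fixes f :: "'b \<Rightarrow> real"
  assumes "finite (set_pmf Q)" "\<And>v. v \<in> set_pmf Q \<Longrightarrow> finite (set_pmf (\<kappa> v))"
  shows "measure_pmf.expectation (bind_pmf Q \<kappa>) f
    = measure_pmf.expectation Q (\<lambda>v. measure_pmf.expectation (\<kappa> v) f)"
  by (subst pmf_expectation_bind[of "set_pmf Q"]) (use assms in \<open>auto simp: expectation_finite\<close>)

lemma expectation_pair_finite:
  fixes f :: "'a \<times> 'b \<Rightarrow> real"
  assumes "finite (set_pmf p)" "finite (set_pmf q)"
  shows "measure_pmf.expectation (pair_pmf p q) f
    = measure_pmf.expectation p (\<lambda>x. measure_pmf.expectation q (\<lambda>y. f (x, y)))"
  unfolding pair_pmf_def
  by (subst expectation_bind_finite; simp add: assms expectation_bind_finite)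

section \<open>Shannon entropy: Gibbs' inequality, submodularity and concavity\<close>

definition ent :: "'a pmf \<Rightarrow> real" where
  "ent p = measure_pmf.expectation p (\<lambda>x. - log 2 (pmf p x))"

lemma ent_map: "ent (map_pmf f p) = measure_pmf.expectation p (\<lambda>x. - log 2 (pmf (map_pmf f p) (f x)))"
  by (simp add: ent_def)

lemma pmf_map_pos: "x \<in> set_pmf p \<Longrightarrow> 0 < pmf (map_pmf f p) (f x)"
  by (intro pmf_positive) auto

lemma log2_le:
  assumes "0 < (x::real)" shows "log 2 x \<le> (x - 1) / ln 2"
  unfolding log_def using ln_le_minus_one[OF assms] by (intro divide_right_mono) auto

lemma ent_nonneg: "finite (set_pmf p) \<Longrightarrow> 0 \<le> ent p"
  unfolding ent_def
  by (intro integral_nonneg_AE) (auto simp: AE_measure_pmf_iff pmf_positive pmf_le_1)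

text \<open>Gibbs' inequality: \<open>log 2 t \<le> (t - 1) / ln 2\<close> at
  \<open>t = g x / pmf p x\<close>, averaged over \<open>p\<close>. The weights may have total mass
  below one, so crude normalisations are allowed.\<close>

lemma ent_le_cross:
  assumes fin: "finite (set_pmf p)" and pos: "\<And>x. x \<in> set_pmf p \<Longrightarrow> 0 < g x"
    and le: "(\<Sum>x\<in>set_pmf p. g x) \<le> 1"
  shows "ent p \<le> measure_pmf.expectation p (\<lambda>x. - log 2 (g x))"
proof -
  have "ent p - measure_pmf.expectation p (\<lambda>x. - log 2 (g x))
      = measure_pmf.expectation p (\<lambda>x. log 2 (g x / pmf p x))"
    unfolding ent_def expectation_diff_finite[OF fin, symmetric]
    by (intro expectation_cong) (simp add: log_divide pos pmf_positive less_imp_neq[symmetric] del: pmf_eq_0_set_pmf)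
  also have "\<dots> \<le> measure_pmf.expectation p (\<lambda>x. (g x / pmf p x - 1) / ln 2)"
    by (intro expectation_mono_finite fin log2_le) (auto simp: pos pmf_positive)
  also have "\<dots> = (measure_pmf.expectation p (\<lambda>x. g x / pmf p x) - 1) / ln 2"
    using expectation_diff_finite[OF fin, of "\<lambda>x. g x / pmf p x" "\<lambda>x. 1"] by simp
  also have "measure_pmf.expectation p (\<lambda>x. g x / pmf p x) = (\<Sum>x\<in>set_pmf p. g x)"
    unfolding expectation_finite[OF fin] by (intro sum.cong) (auto simp: set_pmf_iff)
  also have "(\<dots> - 1) / ln 2 \<le> 0" using le by (simp add: divide_nonpos_pos)
  finally show ?thesis by simp
qed

lemma ent_le_card:
  assumes "finite A" "set_pmf p \<subseteq> A"
  shows "ent p \<le> log 2 (card A)"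
proof -
  have fin: "finite (set_pmf p)" using assms finite_subset by blast
  have ne: "A \<noteq> {}" using assms set_pmf_not_empty[of p] by auto
  then have c: "0 < card A" using assms by (simp add: card_gt_0_iff)
  have "ent p \<le> measure_pmf.expectation p (\<lambda>x. - log 2 (1 / real (card A)))"
  proof (rule ent_le_cross[OF fin])
    show "(\<Sum>x\<in>set_pmf p. 1 / real (card A)) \<le> 1"
      using card_mono[OF assms] c by (simp add: divide_simps)
  qed (use c in auto)
  then show ?thesis using c by (simp add: log_divide)
qed

text \<open>Gibbs' inequality against the law under which \<open>f\<close> and \<open>g\<close> keep
  their marginals but are independent conditionally on their common function
  \<open>h\<close>.\<close>

lemma ent_submodular:
  assumes fin: "finite (set_pmf M)"
    and h: "\<And>x. x \<in> set_pmf M \<Longrightarrow> h x = a (f x)" "\<And>x. x \<in> set_pmf M \<Longrightarrow> h x = b (g x)"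
  shows "ent (map_pmf (\<lambda>x. (f x, g x)) M) + ent (map_pmf h M) \<le> ent (map_pmf f M) + ent (map_pmf g M)"
proof -
  let ?J = "map_pmf (\<lambda>x. (f x, g x)) M"
  let ?w = "\<lambda>(u, w). pmf (map_pmf f M) u * pmf (map_pmf g M) w / pmf (map_pmf h M) (a u)"
  have h1: "map_pmf h M = map_pmf (\<lambda>x. a (f x)) M" "map_pmf h M = map_pmf (\<lambda>x. b (g x)) M"
    using h by (auto intro!: map_pmf_cong)
  have pa: "0 < pmf (map_pmf h M) (a (f x))" if "x \<in> set_pmf M" for x
    using pmf_map_pos[OF that, of h] h(1)[OF that] by simp
  have "ent ?J \<le> measure_pmf.expectation ?J (\<lambda>x. - log 2 (?w x))"
  proof (rule ent_le_cross)
    show "finite (set_pmf ?J)" using fin by simp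
    show "0 < ?w x" if "x \<in> set_pmf ?J" for x
      using that by (auto intro!: divide_pos_pos mult_pos_pos pmf_map_pos pa)
    \<comment> \<open>Every pair in the support is compatible, \<open>b w = a u\<close>. Over all
      compatible pairs the inner sum over \<open>w\<close> cancels the denominator, and the
      remaining masses of \<open>f\<close> add up to one.\<close>
    let ?R = "Sigma (f ` set_pmf M) (\<lambda>u. {w \<in> g ` set_pmf M. b w = a u})"
    have "sum ?w (set_pmf ?J) \<le> sum ?w ?R"
      by (intro sum_mono2) (use fin h in \<open>auto intro!: divide_nonneg_nonneg mult_nonneg_nonneg\<close>)
    also have "\<dots> = (\<Sum>u\<in>f ` set_pmf M. \<Sum>w\<in>{w \<in> g ` set_pmf M. b w = a u}. ?w (u, w))"
      by (subst sum.Sigma) (use fin in auto)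
    also have "\<dots> = (\<Sum>u\<in>f ` set_pmf M. pmf (map_pmf f M) u)"
    proof (rule sum.cong[OF refl])
      fix u assume u: "u \<in> f ` set_pmf M"
      have "(\<Sum>w\<in>{w \<in> g ` set_pmf M. b w = a u}. pmf (map_pmf g M) w)
          = measure (map_pmf g M) {w \<in> g ` set_pmf M. b w = a u}"
        by (subst measure_measure_pmf_finite) (use fin in auto)
      also have "\<dots> = measure (map_pmf g M) (b -` {a u})"
        by (subst (1 2) measure_Int_set_pmf[symmetric], rule arg_cong[where f="measure _"]) auto
      also have "\<dots> = pmf (map_pmf h M) (a u)"
        by (simp add: h1(2) pmf_map vimage_def)
      finally have *: "(\<Sum>w\<in>{w \<in> g ` set_pmf M. b w = a u}. pmf (map_pmf g M) w) = pmf (map_pmf h M) (a u)" .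
      have "(\<Sum>w\<in>{w \<in> g ` set_pmf M. b w = a u}. ?w (u, w))
         = pmf (map_pmf f M) u / pmf (map_pmf h M) (a u) * (\<Sum>w\<in>{w \<in> g ` set_pmf M. b w = a u}. pmf (map_pmf g M) w)"
        by (simp add: sum_distrib_left)
      also have "\<dots> = pmf (map_pmf f M) u"
        unfolding * using u pa by force
      finally show "(\<Sum>w\<in>{w \<in> g ` set_pmf M. b w = a u}. ?w (u, w)) = pmf (map_pmf f M) u" .
    qed
    also have "\<dots> = 1" using sum_pmf_eq_1[of "f ` set_pmf M" "map_pmf f M"] fin by simp
    finally show "sum ?w (set_pmf ?J) \<le> 1" .
  qed
  also have "\<dots> = measure_pmf.expectation M (\<lambda>x. - log 2 (?w (f x, g x)))" by simp
  also have "\<dots> = measure_pmf.expectation M (\<lambda>x. - log 2 (pmf (map_pmf f M) (f x)) + - log 2 (pmf (map_pmf g M) (g x))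
       - (- log 2 (pmf (map_pmf h M) (h x))))"
  proof (rule expectation_cong)
    fix x assume x: "x \<in> set_pmf M"
    show "- log 2 (?w (f x, g x)) = - log 2 (pmf (map_pmf f M) (f x)) + - log 2 (pmf (map_pmf g M) (g x))
       - (- log 2 (pmf (map_pmf h M) (h x)))"
      using pmf_map_pos[OF x, of f] pmf_map_pos[OF x, of g] pa[OF x] h(1)[OF x]
      by (simp add: log_divide log_mult)
  qed
  also have "\<dots> = ent (map_pmf f M) + ent (map_pmf g M) - ent (map_pmf h M)"
    by (simp only: expectation_diff_finite[OF fin] expectation_add_finite[OF fin] ent_map)
  finally show ?thesis by simp
qed

lemma ent_map_le:
  assumes fin: "finite (set_pmf p)"
  shows "ent (map_pmf f p) \<le> ent p"
  unfolding ent_map unfolding ent_def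
proof (intro expectation_mono_finite fin)
  fix x assume x: "x \<in> set_pmf p"
  have "pmf p x \<le> pmf (map_pmf f p) (f x)"
    by (simp add: pmf_map measure_pmf_single[symmetric] measure_pmf.finite_measure_mono)
  then show "- log 2 (pmf (map_pmf f p) (f x)) \<le> - log 2 (pmf p x)"
    using pmf_positive[OF x] by simp
qed

lemma ent_map_fun_le:
  assumes fin: "finite (set_pmf M)" and "\<And>x. x \<in> set_pmf M \<Longrightarrow> f x = a (g x)"
  shows "ent (map_pmf f M) \<le> ent (map_pmf g M)"
proof -
  have "map_pmf f M = map_pmf a (map_pmf g M)"
    unfolding map_pmf_comp using assms(2) by (intro map_pmf_cong) auto
  then show ?thesis using ent_map_le[of "map_pmf g M" a] fin by simp
qed

lemma ent_map_inj:
  assumes fin: "finite (set_pmf p)" and inj: "inj_on f (set_pmf p)"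
  shows "ent (map_pmf f p) = ent p"
  unfolding ent_map unfolding ent_def
  by (intro expectation_cong) (simp add: pmf_map_inj[OF inj])

lemma ent_return [simp]: "ent (return_pmf x) = 0"
  by (simp add: ent_def)

lemma ent_subadditive:
  assumes "finite (set_pmf M)"
  shows "ent (map_pmf (\<lambda>x. (f x, g x)) M) \<le> ent (map_pmf f M) + ent (map_pmf g M)"
  using ent_submodular[OF assms, of "\<lambda>_. ()" "\<lambda>_. ()" f "\<lambda>_. ()" g] by simp

text \<open>Chain rule: the outcome records the label \<open>v\<close>, so its mass factors as
  \<open>pmf Q v * pmf (\<kappa> v) s\<close> and the logarithm splits.\<close>

lemma ent_mixture:
  assumes fin: "finite (set_pmf Q)" "\<And>v. v \<in> set_pmf Q \<Longrightarrow> finite (set_pmf (\<kappa> v))"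
  shows "ent (bind_pmf Q (\<lambda>v. map_pmf (\<lambda>s. (s, v)) (\<kappa> v)))
    = ent Q + measure_pmf.expectation Q (\<lambda>v. ent (\<kappa> v))"
proof -
  let ?M = "bind_pmf Q (\<lambda>v. map_pmf (\<lambda>s. (s, v)) (\<kappa> v))"
  have pmfM: "pmf ?M (s, v) = pmf Q v * pmf (\<kappa> v) s" for s v
  proof -
    have "pmf ?M (s, v) = measure_pmf.expectation Q (\<lambda>v'. measure (\<kappa> v') ((\<lambda>s. (s, v')) -` {(s, v)}))"
      by (simp add: pmf_bind pmf_map)
    also have "\<dots> = (\<Sum>v'\<in>{v}. measure (\<kappa> v') ((\<lambda>s. (s, v')) -` {(s, v)}) * pmf Q v')"
      by (rule integral_measure_pmf_real) (auto simp: vimage_def intro: ccontr)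
    finally show ?thesis by (simp add: vimage_def measure_pmf_single)
  qed
  have "ent ?M = measure_pmf.expectation Q (\<lambda>v. measure_pmf.expectation (\<kappa> v) (\<lambda>s. - log 2 (pmf ?M (s, v))))"
    unfolding ent_def by (subst expectation_bind_finite) (use fin in auto)
  also have "\<dots> = measure_pmf.expectation Q (\<lambda>v. - log 2 (pmf Q v) + ent (\<kappa> v))"
  proof (rule expectation_cong)
    fix v assume v: "v \<in> set_pmf Q"
    have "measure_pmf.expectation (\<kappa> v) (\<lambda>s. - log 2 (pmf ?M (s, v)))
       = measure_pmf.expectation (\<kappa> v) (\<lambda>s. - log 2 (pmf Q v) + - log 2 (pmf (\<kappa> v) s))"
      by (rule expectation_cong)
        (simp add: pmfM log_mult pmf_positive v less_imp_neq[symmetric] del: pmf_eq_0_set_pmf)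
    also have "\<dots> = - log 2 (pmf Q v) + ent (\<kappa> v)"
      unfolding expectation_add_finite[OF fin(2)[OF v]] by (simp add: ent_def)
    finally show "measure_pmf.expectation (\<kappa> v) (\<lambda>s. - log 2 (pmf ?M (s, v))) = - log 2 (pmf Q v) + ent (\<kappa> v)" .
  qed
  finally show ?thesis
    unfolding expectation_add_finite[OF fin(1)] ent_def[of Q] .
qed

lemma ent_pair:
  assumes "finite (set_pmf p)" "finite (set_pmf q)"
  shows "ent (pair_pmf p q) = ent p + ent q"
proof -
  have "pair_pmf p q = bind_pmf q (\<lambda>y. map_pmf (\<lambda>x. (x, y)) p)"
    by (subst pair_commute_pmf) (simp add: pair_pmf_def map_bind_pmf map_pmf_def bind_assoc_pmf bind_return_pmf)
  then show ?thesis using ent_mixture[of q "\<lambda>_. p"] assms by simp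
qed

text \<open>As \<open>g\<close> is a function of \<open>f\<close>, the difference of the entropies of \<open>f\<close> and \<open>g\<close> is the conditional
  entropy of \<open>f\<close> given \<open>g\<close>, which is concave in the distribution.\<close>

lemma cond_ent_mixture:
  assumes fin: "finite (set_pmf Q)" "\<And>v. v \<in> set_pmf Q \<Longrightarrow> finite (set_pmf (\<kappa> v))"
    and g: "\<And>x. g x = a (f x)"
  shows "measure_pmf.expectation Q (\<lambda>v. ent (map_pmf f (\<kappa> v)) - ent (map_pmf g (\<kappa> v)))
    \<le> ent (map_pmf f (bind_pmf Q \<kappa>)) - ent (map_pmf g (bind_pmf Q \<kappa>))"
proof -
  let ?M = "bind_pmf Q (\<lambda>v. map_pmf (\<lambda>s. (s, v)) (\<kappa> v))"
  have finM: "finite (set_pmf ?M)" using fin by auto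
  have e: "ent (map_pmf (\<lambda>(s, v). (r s, v)) ?M) = ent Q + measure_pmf.expectation Q (\<lambda>v. ent (map_pmf r (\<kappa> v)))"
    for r :: "'b \<Rightarrow> 'z"
    using ent_mixture[of Q "\<lambda>v. map_pmf r (\<kappa> v)"] fin by (simp add: map_bind_pmf map_pmf_comp)
  have m: "map_pmf r (bind_pmf Q \<kappa>) = map_pmf (\<lambda>(s, v). r s) ?M" for r :: "'b \<Rightarrow> 'z"
    by (simp add: map_bind_pmf map_pmf_comp)
  \<comment> \<open>Submodularity is applied to \<open>f\<close> and to the pair of \<open>g\<close>
    with the label \<open>v\<close>, whose common function is \<open>g\<close>; their joint variable
    determines \<open>(f, v)\<close>.\<close>
  have "ent (map_pmf (\<lambda>(s, v). (f s, v)) ?M) + ent (map_pmf (\<lambda>(s, v). g s) ?M)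
     \<le> ent (map_pmf (\<lambda>x. (case x of (s, v) \<Rightarrow> f s, case x of (s, v) \<Rightarrow> (g s, v))) ?M) + ent (map_pmf (\<lambda>(s, v). g s) ?M)"
    by (intro add_right_mono ent_map_fun_le[OF finM, where a="\<lambda>(u, w). (u, snd w)"]) auto
  also have "\<dots> \<le> ent (map_pmf (\<lambda>(s, v). f s) ?M) + ent (map_pmf (\<lambda>(s, v). (g s, v)) ?M)"
    by (rule ent_submodular[OF finM, where a=a and b=fst]) (auto simp: g)
  finally show ?thesis
    unfolding e m[of f, symmetric] m[of g, symmetric]
    by (simp add: expectation_diff_finite[OF fin(1)] m)
qed

section \<open>Convolutions on the integers\<close>

definition pconv :: "'a::ab_group_add pmf \<Rightarrow> 'a pmf \<Rightarrow> 'a pmf" where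
  "pconv p q = map_pmf (\<lambda>(x, y). x + y) (pair_pmf p q)"

primrec pconv_pow :: "'a::ab_group_add pmf \<Rightarrow> nat \<Rightarrow> 'a pmf" where
  "pconv_pow q 0 = return_pmf 0"
| "pconv_pow q (Suc k) = pconv q (pconv_pow q k)"

lemma set_pconv: "set_pmf (pconv p q) = (\<lambda>(x, y). x + y) ` (set_pmf p \<times> set_pmf q)"
  by (simp add: pconv_def)

lemma finite_set_pconv [simp]:
  "finite (set_pmf p) \<Longrightarrow> finite (set_pmf q) \<Longrightarrow> finite (set_pmf (pconv p q))"
  by (simp add: set_pconv)

lemma finite_set_pconv_pow [simp]: "finite (set_pmf q) \<Longrightarrow> finite (set_pmf (pconv_pow q k))"
  by (induction k) simp_all

lemma pconv_bind: "pconv p q = bind_pmf p (\<lambda>x. bind_pmf q (\<lambda>y. return_pmf (x + y)))"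
  by (simp add: pconv_def pair_pmf_def map_pmf_def bind_assoc_pmf bind_return_pmf)

lemma pconv_commute: "pconv p q = pconv q p"
  unfolding pconv_bind by (subst bind_commute_pmf) (simp add: add.commute)

lemma pconv_return: "pconv (return_pmf x) q = map_pmf (\<lambda>y. x + y) q"
  by (simp add: pconv_bind bind_return_pmf map_pmf_def)

text \<open>Each of \<open>(x + y, z)\<close> and \<open>(x + z, y)\<close> determines \<open>x + y + z\<close>; together they determine \<open>x\<close>, \<open>y\<close>, \<open>z\<close>.\<close>

lemma ent_pconv_submodular:
  fixes p q r :: "'a::ab_group_add pmf"
  assumes fin: "finite (set_pmf p)" "finite (set_pmf q)" "finite (set_pmf r)"
  shows "ent p + ent (pconv p (pconv q r)) \<le> ent (pconv p q) + ent (pconv p r)"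
proof -
  let ?M = "pair_pmf p (pair_pmf q r)"
  have finM: "finite (set_pmf ?M)" using fin by simp
  have f: "map_pmf (\<lambda>(x, y, z). (x + y, z)) ?M = pair_pmf (pconv p q) r"
    by (simp add: pconv_bind pair_pmf_def map_bind_pmf map_pmf_def bind_assoc_pmf bind_return_pmf)
  have g: "map_pmf (\<lambda>(x, y, z). (x + z, y)) ?M = pair_pmf (pconv p r) q"
    by (simp add: pconv_bind pair_pmf_def map_bind_pmf map_pmf_def bind_assoc_pmf bind_return_pmf)
      (subst bind_commute_pmf[of q r], rule refl)
  have h: "map_pmf (\<lambda>(x, y, z). x + y + z) ?M = pconv p (pconv q r)"
    by (simp add: pconv_bind pair_pmf_def map_bind_pmf map_pmf_def bind_assoc_pmf bind_return_pmf add.assoc)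
  have "ent p + ent q + ent r = ent ?M" using fin by (simp add: ent_pair)
  also have "\<dots> = ent (map_pmf (\<lambda>w. ((\<lambda>(x, y, z). (x + y, z)) w, (\<lambda>(x, y, z). (x + z, y)) w)) ?M)"
    by (rule ent_map_inj[symmetric, OF finM]) (auto simp: inj_on_def)
  finally have "ent p + ent q + ent r + ent (pconv p (pconv q r))
      \<le> ent (pair_pmf (pconv p q) r) + ent (pair_pmf (pconv p r) q)"
    unfolding f[symmetric] g[symmetric] h[symmetric]
    using ent_submodular[OF finM, of "\<lambda>(x, y, z). x + y + z" "\<lambda>(u, v). u + v" "\<lambda>(x, y, z). (x + y, z)"
        "\<lambda>(u, v). u + v" "\<lambda>(x, y, z). (x + z, y)"]
    by (simp add: case_prod_unfold algebra_simps)
  then show ?thesis using fin by (simp add: ent_pair)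
qed

text \<open>No further copy of \<open>q\<close> gains more entropy than the first one did:
  submodularity with the sum of the earlier copies as third summand.\<close>

lemma ent_pconv_pow_le:
  fixes p q :: "'a::ab_group_add pmf"
  assumes fin: "finite (set_pmf p)" "finite (set_pmf q)"
  shows "ent (pconv p (pconv_pow q k)) \<le> ent p + real k * (ent (pconv p q) - ent p)"
proof (induction k)
  case 0
  show ?case by (simp add: pconv_commute[of p] pconv_return map_pmf_ident)
next
  case (Suc k)
  then show ?case
    using ent_pconv_submodular[of p q "pconv_pow q k"] fin by (simp add: algebra_simps)
qed

text \<open>Either variable is recovered from the other and one extra bit. This absorbs all carries
  and rounding errors.\<close>

lemma ent_floor_shift:
  fixes f g :: "'a \<Rightarrow> int"
  assumes fin: "finite (set_pmf M)" and d: "\<And>x. x \<in> set_pmf M \<Longrightarrow> f x - g x - c \<in> {0, 1}"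
  shows "\<bar>ent (map_pmf f M) - ent (map_pmf g M)\<bar> \<le> 1"
proof -
  have *: "ent (map_pmf f M) \<le> ent (map_pmf g M) + 1"
    if d: "\<And>x. x \<in> set_pmf M \<Longrightarrow> f x - g x - c \<in> {0, 1}" for f g :: "'a \<Rightarrow> int" and c
  proof -
    have "ent (map_pmf f M) \<le> ent (map_pmf (\<lambda>x. (g x, f x - g x)) M)"
      by (rule ent_map_fun_le[OF fin, of _ "\<lambda>(u, d). u + d"]) simp
    also have "\<dots> \<le> ent (map_pmf g M) + ent (map_pmf (\<lambda>x. f x - g x) M)"
      by (rule ent_subadditive[OF fin])
    also have "ent (map_pmf (\<lambda>x. f x - g x) M) \<le> log 2 (card {c, c + 1})"
      by (rule ent_le_card) (use d in force)+
    also have "log 2 (card {c, c + 1}) = 1" by simp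
    finally show ?thesis by simp
  qed
  \<comment> \<open>Exchanging the roles turns the offsets \<open>c\<close>, \<open>c + 1\<close>
    into \<open>- c - 1\<close>, \<open>- c\<close>, again two consecutive integers.\<close>
  have "ent (map_pmf g M) \<le> ent (map_pmf f M) + 1"
  proof (rule *)
    fix x assume "x \<in> set_pmf M"
    from d[OF this] show "g x - f x - (- c - 1) \<in> {0, 1}" by auto
  qed
  with *[of f g c, OF d] show ?thesis by simp
qed

text \<open>Scales count upwards from the finest: if \<open>p\<close> is the law of the
  level-\<open>n\<close> index, this is the entropy at level \<open>n - r\<close>.\<close>

definition lev_ent :: "int pmf \<Rightarrow> nat \<Rightarrow> real" where
  "lev_ent p r = ent (map_pmf (\<lambda>x. x div 2 ^ r) p)"

lemma div_add_carry:
  fixes x w b :: int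
  assumes "b > 0"
  shows "(x + w) div b - x div b - w div b \<in> {0, 1}"
proof -
  let ?s = "x mod b + w mod b"
  have s: "0 \<le> ?s" "?s < b + b"
    by (intro add_nonneg_nonneg add_strict_mono pos_mod_sign pos_mod_bound assms)+
  have "?s div b \<in> {0, 1}"
  proof (cases "?s < b")
    case True
    then show ?thesis using s by (simp add: div_pos_pos_trivial)
  next
    case False
    then have "(?s - b) div b = 0" using s by (intro div_pos_pos_trivial) auto
    then show ?thesis using div_add_self2[of b "?s - b"] assms by simp
  qed
  then show ?thesis by (simp add: div_add1_eq[of x w b])
qed

text \<open>Given the independent summand, the sum is a translate of \<open>p\<close>, which moves
  each of the two level entropies by at most 1. Concavity of conditional entropy then removes the
  conditioning.\<close>

lemma lev_ent_pconv_diff: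
  assumes fin: "finite (set_pmf p)" "finite (set_pmf w)" and "a \<le> b"
  shows "lev_ent p a - lev_ent p b - 2 \<le> lev_ent (pconv p w) a - lev_ent (pconv p w) b"
proof -
  have eq: "pconv p w = bind_pmf w (\<lambda>y. map_pmf (\<lambda>x. x + y) p)"
    unfolding pconv_bind by (subst bind_commute_pmf) (simp add: map_pmf_def)
  have shift: "lev_ent p r - 1 \<le> ent (map_pmf (\<lambda>x. x div 2 ^ r) (map_pmf (\<lambda>x. x + y) p))"
    "ent (map_pmf (\<lambda>x. x div 2 ^ r) (map_pmf (\<lambda>x. x + y) p)) \<le> lev_ent p r + 1" for r y
  proof -
    have c: "(x + y) div 2 ^ r - x div 2 ^ r - y div 2 ^ r \<in> {0, 1}" for x
      by (rule div_add_carry) simp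
    have "\<bar>ent (map_pmf (\<lambda>x. (x + y) div 2 ^ r) p) - lev_ent p r\<bar> \<le> 1" unfolding lev_ent_def
      by (rule ent_floor_shift[OF fin(1), of _ _ "y div 2 ^ r"]) (rule c)
    then show "lev_ent p r - 1 \<le> ent (map_pmf (\<lambda>x. x div 2 ^ r) (map_pmf (\<lambda>x. x + y) p))"
      "ent (map_pmf (\<lambda>x. x div 2 ^ r) (map_pmf (\<lambda>x. x + y) p)) \<le> lev_ent p r + 1"
      unfolding map_pmf_comp by linarith+
  qed
  have comp: "x div 2 ^ b = x div 2 ^ a div 2 ^ (b - a)" for x :: int
    using \<open>a \<le> b\<close> by (simp add: zdiv_zmult2_eq[symmetric] power_add[symmetric])
  have "lev_ent p a - lev_ent p b - 2 = measure_pmf.expectation w (\<lambda>_. lev_ent p a - lev_ent p b - 2)" by simp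
  also have "\<dots> \<le> measure_pmf.expectation w (\<lambda>y. ent (map_pmf (\<lambda>x. x div 2 ^ a) (map_pmf (\<lambda>x. x + y) p))
      - ent (map_pmf (\<lambda>x. x div 2 ^ b) (map_pmf (\<lambda>x. x + y) p)))"
  proof (intro expectation_mono_finite fin)
    fix y
    show "lev_ent p a - lev_ent p b - 2 \<le> ent (map_pmf (\<lambda>x. x div 2 ^ a) (map_pmf (\<lambda>x. x + y) p))
      - ent (map_pmf (\<lambda>x. x div 2 ^ b) (map_pmf (\<lambda>x. x + y) p))"
      using shift(1)[of a y] shift(2)[of b y] by linarith
  qed
  also have "\<dots> \<le> lev_ent (pconv p w) a - lev_ent (pconv p w) b"
    unfolding eq lev_ent_def
    by (rule cond_ent_mixture[where a = "\<lambda>u. u div 2 ^ (b - a)"]) (use fin comp in auto)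
  finally show ?thesis .
qed

text \<open>Neighbouring scales differ by one binary digit. Hence the deficits
  \<open>1 - (lev_ent p r - lev_ent p (Suc r))\<close> are non-negative.\<close>

lemma lev_ent_step_le:
  assumes "finite (set_pmf p)"
  shows "lev_ent p r - lev_ent p (Suc r) \<le> 1"
proof -
  have d: "x div 2 ^ Suc r = x div 2 ^ r div 2" for x :: int
    by (simp add: zdiv_zmult2_eq[symmetric] mult.commute)
  have "lev_ent p r \<le> ent (map_pmf (\<lambda>x. (x div 2 ^ Suc r, x div 2 ^ r mod 2)) p)"
    unfolding lev_ent_def by (rule ent_map_fun_le[OF assms, of _ "\<lambda>(u, v). 2 * u + v"]) (simp only: d, simp)
  also have "\<dots> \<le> lev_ent p (Suc r) + ent (map_pmf (\<lambda>x. x div 2 ^ r mod 2) p)"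
    unfolding lev_ent_def by (rule ent_subadditive[OF assms])
  also have "ent (map_pmf (\<lambda>x. x div 2 ^ r mod 2) p) \<le> log 2 (card {0, 1::int})"
    by (rule ent_le_card) auto
  finally show ?thesis by simp
qed

lemma lev_ent_nonneg: "finite (set_pmf p) \<Longrightarrow> 0 \<le> lev_ent p r"
  by (simp add: lev_ent_def ent_nonneg)

section \<open>Entropy of sums of many independent variables\<close>

text \<open>The probability that two independent samples agree, that is, the sum of the squared
  masses.\<close>

definition collision :: "'a pmf \<Rightarrow> real" where
  "collision p = measure_pmf.expectation p (pmf p)"

text \<open>The logarithm is replaced by its tangent at \<open>1 / K\<close>. The bound is affine in
  the collision probability and can therefore be averaged over a conditioning.\<close>

lemma ent_ge_collision:
  assumes fin: "finite (set_pmf p)" and K: "0 < K"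
  shows "log 2 K - (K * collision p - 1) / ln 2 \<le> ent p"
proof -
  have "log 2 K - (K * collision p - 1) / ln 2 = measure_pmf.expectation p (\<lambda>x. log 2 K - (K * pmf p x - 1) / ln 2)"
    using expectation_diff_finite[OF fin, of "\<lambda>x. log 2 K" "\<lambda>x. (K * pmf p x - 1) / ln 2"]
      expectation_diff_finite[OF fin, of "\<lambda>x. K * pmf p x" "\<lambda>x. 1"]
    by (simp add: collision_def)
  also have "\<dots> \<le> ent p" unfolding ent_def
  proof (intro expectation_mono_finite fin)
    fix x assume "x \<in> set_pmf p"
    then have "0 < pmf p x" by (rule pmf_positive)
    then show "log 2 K - (K * pmf p x - 1) / ln 2 \<le> - log 2 (pmf p x)"
      using log2_le[of "K * pmf p x"] K by (simp add: log_mult)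
  qed
  finally show ?thesis .
qed

lemma collision_map:
  assumes fin: "finite (set_pmf p)"
  shows "collision (map_pmf f p) = measure_pmf.expectation p (\<lambda>x. measure_pmf.expectation p (\<lambda>y. of_bool (f x = f y)))"
proof -
  have "pmf (map_pmf f p) (f x) = measure_pmf.expectation p (\<lambda>y. of_bool (f x = f y))" for x
  proof -
    have "measure_pmf.expectation p (\<lambda>y. of_bool (f x = f y)) = measure_pmf.expectation p (indicat_real (f -` {f x}))"
      by (intro expectation_cong) (auto simp: indicator_def)
    then show ?thesis by (simp add: pmf_map)
  qed
  then show ?thesis by (simp add: collision_def)
qed

text \<open>The squared modulus of the characteristic function, in real terms.\<close>

definition char_sq :: "int pmf \<Rightarrow> real \<Rightarrow> real" where
  "char_sq p t = (measure_pmf.expectation p (\<lambda>x. cos (t * of_int x)))\<^sup>2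
    + (measure_pmf.expectation p (\<lambda>x. sin (t * of_int x)))\<^sup>2"

lemma char_sq_nonneg: "0 \<le> char_sq p t"
  by (simp add: char_sq_def)

lemma char_sq_return [simp]: "char_sq (return_pmf x) t = 1"
  by (simp add: char_sq_def)

lemma char_sq_pconv:
  assumes fin: "finite (set_pmf p)" "finite (set_pmf q)"
  shows "char_sq (pconv p q) t = char_sq p t * char_sq q t"
proof -
  let ?C = "\<lambda>p. measure_pmf.expectation p (\<lambda>x. cos (t * of_int x))"
  let ?S = "\<lambda>p. measure_pmf.expectation p (\<lambda>x. sin (t * of_int x))"
  have "?C (pconv p q) = ?C p * ?C q - ?S p * ?S q"
    using fin by (simp add: pconv_def expectation_pair_finite distrib_left cos_add expectation_diff_finite)
  moreover have "?S (pconv p q) = ?S p * ?C q + ?C p * ?S q"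
    using fin by (simp add: pconv_def expectation_pair_finite distrib_left sin_add expectation_add_finite)
  ultimately show ?thesis
    unfolding char_sq_def by (simp only:) (simp add: power2_eq_square algebra_simps)
qed

lemma char_sq_pair:
  assumes fin: "finite (set_pmf p)"
  shows "char_sq p t = measure_pmf.expectation p (\<lambda>x. measure_pmf.expectation p (\<lambda>y. cos (t * of_int (x - y))))"
  using fin by (simp add: char_sq_def right_diff_distrib cos_diff expectation_add_finite power2_eq_square)

section \<open>Variance and the decay of characteristic functions\<close>

definition var_pmf :: "int pmf \<Rightarrow> real" where
  "var_pmf p = measure_pmf.variance p of_int"

lemma var_pmf_eq:
  assumes fin: "finite (set_pmf p)"
  shows "var_pmf p = measure_pmf.expectation p (\<lambda>x. (of_int x)\<^sup>2) - (measure_pmf.expectation p of_int)\<^sup>2"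
  unfolding var_pmf_def by (rule measure_pmf.variance_eq) (intro integrable_measure_pmf_finite fin)+

lemma var_pmf_pair:
  assumes fin: "finite (set_pmf p)"
  shows "measure_pmf.expectation p (\<lambda>x. measure_pmf.expectation p (\<lambda>y. (of_int (x - y))\<^sup>2)) = 2 * var_pmf p"
  using fin by (simp add: var_pmf_eq power2_diff expectation_add_finite expectation_diff_finite)
     (simp add: power2_eq_square)

lemma var_pmf_nonneg: "0 \<le> var_pmf p"
  by (simp add: var_pmf_def)

lemma var_pmf_return [simp]: "var_pmf (return_pmf x) = 0"
  by (simp add: var_pmf_def)

lemma var_pmf_pconv:
  assumes fin: "finite (set_pmf p)" "finite (set_pmf q)"
  shows "var_pmf (pconv p q) = var_pmf p + var_pmf q"
  using fin by (simp add: var_pmf_eq)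
    (simp add: pconv_def expectation_pair_finite power2_sum expectation_add_finite algebra_simps)

lemma var_pmf_le:
  assumes fin: "finite (set_pmf p)" and "\<And>x y. x \<in> set_pmf p \<Longrightarrow> y \<in> set_pmf p \<Longrightarrow> \<bar>x - y\<bar> \<le> B"
  shows "var_pmf p \<le> (of_int B)\<^sup>2"
proof -
  have "(of_int (x - y) :: real)\<^sup>2 \<le> (of_int B)\<^sup>2" if "x \<in> set_pmf p" "y \<in> set_pmf p" for x y
  proof -
    have "\<bar>x - y\<bar> \<le> \<bar>B\<bar>" using assms(2)[OF that] by simp
    then have "(x - y)\<^sup>2 \<le> B\<^sup>2" by (simp only: abs_le_square_iff)
    then show ?thesis by (metis of_int_le_iff of_int_power)
  qed
  then have "2 * var_pmf p \<le> measure_pmf.expectation p (\<lambda>x. measure_pmf.expectation p (\<lambda>y. (of_int B)\<^sup>2))"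
    unfolding var_pmf_pair[OF fin, symmetric] by (intro expectation_mono_finite fin)
  also have "\<dots> = (of_int B)\<^sup>2" by simp
  finally have "2 * var_pmf p \<le> (of_int B)\<^sup>2" .
  then show ?thesis using var_pmf_nonneg[of p] by linarith
qed

lemma cos_ge_half: "\<bar>u\<bar> \<le> 1 \<Longrightarrow> 1 / 2 \<le> cos (u::real)"
proof -
  assume u: "\<bar>u\<bar> \<le> 1"
  have "cos (pi / 3) \<le> cos \<bar>u\<bar>"
    by (rule cos_monotone_0_pi_le) (use u pi_gt3 in auto)
  then show ?thesis by (simp add: cos_60)
qed

text \<open>Half-angle formula, with \<open>v / 2 \<le> sin v\<close> on the unit interval from the
  mean value theorem.\<close>

lemma cos_le_quadratic:
  assumes "\<bar>u\<bar> \<le> (1::real)"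
  shows "cos u \<le> 1 - u\<^sup>2 / 8"
proof -
  have pos: "v / 2 \<le> sin v" if "0 \<le> v" "v \<le> 1" for v :: real
  proof (cases "v = 0")
    case False
    then have "0 < v" using that by simp
    from MVT2[OF this, of sin cos] obtain z where "0 < z" "z < v" "sin v - sin 0 = (v - 0) * cos z"
      by (auto intro: DERIV_sin)
    moreover then have "1 / 2 \<le> cos z" using that by (intro cos_ge_half) auto
    ultimately show ?thesis using mult_left_mono[of "1/2" "cos z" v] that by simp
  qed simp
  have "\<bar>u\<bar> / 4 \<le> sin (\<bar>u\<bar> / 2)" using pos[of "\<bar>u\<bar> / 2"] assms by simp
  then have "(\<bar>u\<bar> / 4)\<^sup>2 \<le> (sin (\<bar>u\<bar> / 2))\<^sup>2" by (intro power_mono) auto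
  moreover have "cos u = 1 - 2 * (sin (\<bar>u\<bar> / 2))\<^sup>2"
    using cos_double_sin[of "\<bar>u\<bar> / 2"] by simp
  ultimately show ?thesis by (simp add: power_divide)
qed

text \<open>The squared modulus is the mean of \<open>cos (t * (x - y))\<close> over two independent
  samples, and the mean square of \<open>x - y\<close> is twice the variance; \<open>small\<close>
  keeps the angles where the quadratic bound holds.\<close>

lemma char_sq_le:
  assumes fin: "finite (set_pmf p)"
    and small: "\<And>x y. x \<in> set_pmf p \<Longrightarrow> y \<in> set_pmf p \<Longrightarrow> \<bar>t * of_int (x - y)\<bar> \<le> 1"
  shows "char_sq p t \<le> 1 - t\<^sup>2 * var_pmf p / 4"
proof -
  have "char_sq p t \<le> measure_pmf.expectation p (\<lambda>x. measure_pmf.expectation p (\<lambda>y. 1 - t\<^sup>2 / 8 * (of_int (x - y))\<^sup>2))"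
    unfolding char_sq_pair[OF fin]
    by (intro expectation_mono_finite fin) (use cos_le_quadratic[OF small] in \<open>simp add: power_mult_distrib\<close>)
  also have "\<dots> = 1 - t\<^sup>2 / 8 * (2 * var_pmf p)"
    by (simp only: var_pmf_pair[OF fin, symmetric] expectation_diff_finite[OF fin] integral_mult_right_zero) simp
  finally show ?thesis by (simp add: mult.commute)
qed

lemma sum_cos_diff:
  "(\<Sum>j<L. \<Sum>j'<L. cos ((real j - real j') * \<theta>)) = (\<Sum>j<L. cos (real j * \<theta>))\<^sup>2 + (\<Sum>j<L. sin (real j * \<theta>))\<^sup>2"
  by (simp add: left_diff_distrib cos_diff sum.distrib power2_eq_square sum_product)

text \<open>A discrete form of Esseen's inequality: a Fejer kernel, non-negative everywhere and at least
  \<open>L\<^sup>2 / 4\<close> on differences smaller than \<open>B\<close>, dominates the collision indicator.\<close>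

lemma collision_div_le:
  fixes p :: "int pmf" and B L :: nat
  assumes fin: "finite (set_pmf p)" and "0 < B" "0 < L"
  shows "collision (map_pmf (\<lambda>x. x div int B) p) * (real L)\<^sup>2 / 4
    \<le> (\<Sum>j<L. \<Sum>j'<L. char_sq p ((real j - real j') / (real B * real L)))"
proof -
  let ?K = "\<lambda>x y. \<Sum>j<L. \<Sum>j'<L. cos ((real j - real j') / (real B * real L) * of_int (x - y))"
  have "collision (map_pmf (\<lambda>x. x div int B) p) * (real L)\<^sup>2 / 4
     = measure_pmf.expectation p (\<lambda>x. measure_pmf.expectation p (\<lambda>y. of_bool (x div int B = y div int B) * (real L)\<^sup>2 / 4))"
    by (simp add: collision_map[OF fin])
  also have "\<dots> \<le> measure_pmf.expectation p (\<lambda>x. measure_pmf.expectation p (\<lambda>y. ?K x y))"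
  proof (intro expectation_mono_finite fin)
    fix x y :: int
    define \<theta> where "\<theta> = of_int (x - y) / (real B * real L)"
    have K: "?K x y = (\<Sum>j<L. cos (real j * \<theta>))\<^sup>2 + (\<Sum>j<L. sin (real j * \<theta>))\<^sup>2"
      unfolding sum_cos_diff[symmetric] by (simp only: \<theta>_def times_divide_eq_left times_divide_eq_right)
    show "of_bool (x div int B = y div int B) * (real L)\<^sup>2 / 4 \<le> ?K x y"
    proof (cases "x div int B = y div int B")
      case True
      have "\<bar>x - y\<bar> = \<bar>x mod int B - y mod int B\<bar>"
        using True div_mult_mod_eq[of x "int B"] div_mult_mod_eq[of y "int B"] by (smt (verit))
      also have "\<dots> \<le> int B"
        using \<open>0 < B\<close> pos_mod_bound[of "int B" x] pos_mod_bound[of "int B" y]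
          pos_mod_sign[of "int B" x] pos_mod_sign[of "int B" y] by (smt (verit) of_nat_0_less_iff)
      finally have d: "\<bar>of_int (x - y) :: real\<bar> \<le> real B" by (metis of_int_abs of_int_le_iff of_int_of_nat_eq)
      \<comment> \<open>Within one cell all angles \<open>j * \<theta>\<close> are at most 1 in
        modulus, so the cosine sum alone is at least \<open>L / 2\<close>.\<close>
      have "1 / 2 \<le> cos (real j * \<theta>)" if "j < L" for j
      proof (rule cos_ge_half)
        have "real j * \<bar>of_int (x - y)\<bar> \<le> real L * real B"
          using d that by (intro mult_mono) auto
        then show "\<bar>real j * \<theta>\<bar> \<le> 1"
          using assms by (simp add: \<theta>_def abs_mult divide_le_eq mult.commute del: of_int_diff)
      qed
      then have "(\<Sum>j<L. 1 / 2) \<le> (\<Sum>j<L. cos (real j * \<theta>))" by (intro sum_mono) auto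
      then have "(real L / 2)\<^sup>2 \<le> (\<Sum>j<L. cos (real j * \<theta>))\<^sup>2" by (intro power_mono) auto
      then show ?thesis unfolding K by (simp add: True power_divide add_increasing2)
    next
      case False
      then show ?thesis unfolding K by simp
    qed
  qed
  also have "\<dots> = (\<Sum>j<L. \<Sum>j'<L. char_sq p ((real j - real j') / (real B * real L)))"
    unfolding char_sq_pair[OF fin]
    by (simp only: Bochner_Integration.integral_sum integrable_measure_pmf_finite[OF fin])
  finally show ?thesis .
qed

section \<open>Geometric sums and the entropy of concentrated distributions\<close>

lemma sum_power_inj_le:
  fixes \<rho> :: real
  assumes "finite F" "inj_on f F" "0 \<le> \<rho>" "\<rho> < 1"
  shows "(\<Sum>x\<in>F. \<rho> ^ f x) \<le> 1 / (1 - \<rho>)"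
proof -
  have "(\<Sum>x\<in>F. \<rho> ^ f x) = (\<Sum>n\<in>f ` F. \<rho> ^ n)"
    by (simp add: sum.reindex assms)
  also have "\<dots> \<le> (\<Sum>n. \<rho> ^ n)"
    by (intro sum_le_suminf) (use assms in auto)
  also have "\<dots> = 1 / (1 - \<rho>)" using assms by (simp add: suminf_geometric)
  finally show ?thesis .
qed

text \<open>On each side of \<open>a\<close> the distances are distinct, so each side is at most a
  full geometric series.\<close>

lemma sum_power_dist_le:
  fixes \<rho> :: real and a :: int
  assumes "finite F" "0 \<le> \<rho>" "\<rho> < 1"
  shows "(\<Sum>x\<in>F. \<rho> ^ nat \<bar>x - a\<bar>) \<le> 2 / (1 - \<rho>)"
proof -
  let ?g = "\<lambda>x. \<rho> ^ nat \<bar>x - a\<bar>"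
  have "(\<Sum>x\<in>F. ?g x) = (\<Sum>x\<in>F \<inter> {a..}. ?g x) + (\<Sum>x\<in>F - {a..}. ?g x)"
    using assms by (subst sum.union_disjoint[symmetric]) (auto intro!: sum.cong)
  also have "\<dots> \<le> 1 / (1 - \<rho>) + 1 / (1 - \<rho>)"
    by (intro add_mono sum_power_inj_le) (use assms in \<open>auto simp: inj_on_def\<close>)
  finally show ?thesis by simp
qed

text \<open>Cross entropy against a two-sided geometric distribution centred at \<open>a\<close>.\<close>

lemma ent_le_abs:
  fixes p :: "int pmf"
  assumes fin: "finite (set_pmf p)"
  shows "ent p \<le> 2 + measure_pmf.expectation p (\<lambda>x. \<bar>of_int (x - a)\<bar>)"
proof -
  let ?g = "\<lambda>x. (1 / 2 :: real) ^ nat \<bar>x - a\<bar>"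
  \<comment> \<open>The normalisation 4 is the bound \<open>2 / (1 - \<rho>)\<close> at
    \<open>\<rho> = 1 / 2\<close>.\<close>
  have s: "(\<Sum>x\<in>set_pmf p. ?g x / 4) \<le> 1"
    using sum_power_dist_le[OF fin, of "1 / 2" a] by (simp flip: sum_divide_distrib)
  have "ent p \<le> measure_pmf.expectation p (\<lambda>x. - log 2 (?g x / 4))"
    by (rule ent_le_cross[OF fin _ s]) simp
  also have "\<dots> = measure_pmf.expectation p (\<lambda>x. 2 + \<bar>of_int (x - a)\<bar>)"
  proof (rule expectation_cong)
    fix x
    have "log 2 (4::real) = 2" using log_nat_power[of 2 2 2] by simp
    then show "- log 2 (?g x / 4) = 2 + \<bar>of_int (x - a)\<bar>"
      by (simp add: log_divide log_nat_power del: of_int_diff)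
  qed
  also have "\<dots> = 2 + measure_pmf.expectation p (\<lambda>x. \<bar>of_int (x - a)\<bar>)"
    by (subst expectation_add_finite[OF fin]) simp
  finally show ?thesis .
qed

text \<open>When the standard deviation is at most \<open>b\<close>, the cell index is at mean
  distance at most \<open>3 / 2 + 1 / 2\<close> from that of the mean; the cross entropy bound adds
  2.\<close>

lemma ent_div_le_var:
  fixes p :: "int pmf" and b :: nat
  assumes fin: "finite (set_pmf p)" and "0 < b" and var_pmf: "var_pmf p \<le> (real b)\<^sup>2"
  shows "ent (map_pmf (\<lambda>x. x div int b) p) \<le> 4"
proof -
  define m :: real where "m = measure_pmf.expectation p of_int"
  have m: "measure_pmf.expectation p (\<lambda>x. (of_int x - m)\<^sup>2) = var_pmf p"
    by (simp add: var_pmf_def m_def)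
  have am: "\<bar>u\<bar> \<le> 1 / 2 + u\<^sup>2 / 2" for u :: real
    using zero_le_power2[of "\<bar>u\<bar> - 1"] by (simp add: power2_diff)
  have "ent (map_pmf (\<lambda>x. x div int b) p) \<le> 2 + measure_pmf.expectation p (\<lambda>x. \<bar>of_int (x div int b - \<lfloor>m / b\<rfloor>)\<bar>)"
    using ent_le_abs[of "map_pmf (\<lambda>x. x div int b) p"] fin by simp
  also have "measure_pmf.expectation p (\<lambda>x. \<bar>of_int (x div int b - \<lfloor>m / b\<rfloor>)\<bar>)
    \<le> measure_pmf.expectation p (\<lambda>x. 3 / 2 + (of_int x - m)\<^sup>2 / (2 * (real b)\<^sup>2))"
  proof (intro expectation_mono_finite fin)
    fix x :: int
    have "x div int b = \<lfloor>of_int x / real b\<rfloor>" by (metis floor_divide_of_int_eq of_int_of_nat_eq)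
    then have "\<bar>of_int (x div int b - \<lfloor>m / b\<rfloor>)\<bar> \<le> \<bar>of_int x / b - m / b\<bar> + 1" by linarith
    also have "of_int x / b - m / b = (of_int x - m) / b" by (simp add: diff_divide_distrib)
    also have "\<bar>(of_int x - m) / b\<bar> \<le> 1 / 2 + ((of_int x - m) / b)\<^sup>2 / 2"
      by (rule am)
    also have "((of_int x - m) / b)\<^sup>2 / 2 = (of_int x - m)\<^sup>2 / (2 * (real b)\<^sup>2)" by (simp add: power_divide)
    finally show "\<bar>of_int (x div int b - \<lfloor>m / b\<rfloor>)\<bar> \<le> 3 / 2 + (of_int x - m)\<^sup>2 / (2 * (real b)\<^sup>2)" by simp
  qed
  also have "\<dots> = 3 / 2 + var_pmf p / (2 * (real b)\<^sup>2)"
    by (subst expectation_add_finite[OF fin]) (simp add: m)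
  also have "\<dots> \<le> 3 / 2 + 1 / 2" using var_pmf \<open>0 < b\<close> by (simp add: divide_simps)
  finally show ?thesis by simp
qed

section \<open>Sums of independent copies, conditioned on their labels\<close>

primrec ksum :: "('c \<Rightarrow> int pmf) \<Rightarrow> 'c list \<Rightarrow> int pmf" where
  "ksum \<kappa> [] = return_pmf 0"
| "ksum \<kappa> (c # v) = pconv (\<kappa> c) (ksum \<kappa> v)"

lemma finite_replicate_pmf [simp]:
  assumes "finite (set_pmf Q)"
  shows "finite (set_pmf (replicate_pmf k Q))"
proof -
  have "set_pmf (replicate_pmf k Q) = {v. set v \<subseteq> set_pmf Q \<and> length v = k}"
    by (auto simp: set_replicate_pmf)
  then show ?thesis using finite_lists_length_eq[OF assms] by simp
qed

lemma finite_set_ksum: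
  "(\<And>c. c \<in> set v \<Longrightarrow> finite (set_pmf (\<kappa> c))) \<Longrightarrow> finite (set_pmf (ksum \<kappa> v))"
  by (induction v) simp_all

text \<open>Drawing all labels first and then the summands gives the same sum as drawing whole
  copies, so estimates may be made conditionally on the labels.\<close>

lemma bind_replicate_ksum: "bind_pmf (replicate_pmf k Q) (ksum \<kappa>) = pconv_pow (bind_pmf Q \<kappa>) k"
proof (induction k)
  case 0
  show ?case by (simp add: bind_return_pmf)
next
  case (Suc k)
  have "pconv_pow (bind_pmf Q \<kappa>) (Suc k) = pconv (bind_pmf Q \<kappa>) (bind_pmf (replicate_pmf k Q) (ksum \<kappa>))"
    by (simp add: Suc)
  also have "\<dots> = bind_pmf Q (\<lambda>c. bind_pmf (\<kappa> c) (\<lambda>x. bind_pmf (replicate_pmf k Q)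
      (\<lambda>v. bind_pmf (ksum \<kappa> v) (\<lambda>y. return_pmf (x + y)))))"
    by (simp add: pconv_bind bind_assoc_pmf)
  also have "\<dots> = bind_pmf Q (\<lambda>c. bind_pmf (replicate_pmf k Q) (\<lambda>v. pconv (\<kappa> c) (ksum \<kappa> v)))"
    unfolding pconv_bind by (subst bind_commute_pmf) (rule refl)
  also have "\<dots> = bind_pmf (replicate_pmf (Suc k) Q) (ksum \<kappa>)"
    by (simp add: bind_assoc_pmf bind_return_pmf)
  finally show ?case by simp
qed

text \<open>The squared modulus is multiplicative given the labels, and the labels are independent,
  so the average factors as well.\<close>

lemma expectation_char_sq_ksum:
  assumes fin: "finite (set_pmf Q)" "\<And>c. c \<in> set_pmf Q \<Longrightarrow> finite (set_pmf (\<kappa> c))"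
  shows "measure_pmf.expectation (replicate_pmf k Q) (\<lambda>v. char_sq (ksum \<kappa> v) t)
    = measure_pmf.expectation Q (\<lambda>c. char_sq (\<kappa> c) t) ^ k"
proof (induction k)
  case 0
  show ?case by simp
next
  case (Suc k)
  have "measure_pmf.expectation (replicate_pmf (Suc k) Q) (\<lambda>v. char_sq (ksum \<kappa> v) t)
     = measure_pmf.expectation Q (\<lambda>c. measure_pmf.expectation (replicate_pmf k Q) (\<lambda>v. char_sq (pconv (\<kappa> c) (ksum \<kappa> v)) t))"
    using fin by (simp add: expectation_bind_finite)
  also have "\<dots> = measure_pmf.expectation Q (\<lambda>c. char_sq (\<kappa> c) t * measure_pmf.expectation (replicate_pmf k Q) (\<lambda>v. char_sq (ksum \<kappa> v) t))"
  proof (rule expectation_cong)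
    fix c assume c: "c \<in> set_pmf Q"
    have "measure_pmf.expectation (replicate_pmf k Q) (\<lambda>v. char_sq (pconv (\<kappa> c) (ksum \<kappa> v)) t)
       = measure_pmf.expectation (replicate_pmf k Q) (\<lambda>v. char_sq (\<kappa> c) t * char_sq (ksum \<kappa> v) t)"
      by (intro expectation_cong char_sq_pconv finite_set_ksum fin c) (auto simp: set_replicate_pmf intro: fin)
    then show "measure_pmf.expectation (replicate_pmf k Q) (\<lambda>v. char_sq (pconv (\<kappa> c) (ksum \<kappa> v)) t)
       = char_sq (\<kappa> c) t * measure_pmf.expectation (replicate_pmf k Q) (\<lambda>v. char_sq (ksum \<kappa> v) t)"
      by simp
  qed
  finally show ?case by (simp add: Suc)
qed

lemma var_pmf_ksum_le:
  assumes "\<And>c. c \<in> set v \<Longrightarrow> finite (set_pmf (\<kappa> c))" "\<And>c. c \<in> set v \<Longrightarrow> var_pmf (\<kappa> c) \<le> D"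
  shows "var_pmf (ksum \<kappa> v) \<le> real (length v) * D"
  using assms
proof (induction v)
  case (Cons c v)
  then have "var_pmf (ksum \<kappa> v) \<le> real (length v) * D" "var_pmf (\<kappa> c) \<le> D" by auto
  moreover have "var_pmf (ksum \<kappa> (c # v)) = var_pmf (\<kappa> c) + var_pmf (ksum \<kappa> v)"
    using Cons.prems by (simp add: var_pmf_pconv finite_set_ksum)
  ultimately show ?case by (simp add: algebra_simps)
qed simp

text \<open>The library leaves \<^const>\<open>cond_pmf\<close> unspecified on null events, so fibers are meaningful only over
  the image of the support.\<close>

abbreviation fiber :: "'a pmf \<Rightarrow> ('a \<Rightarrow> 'b) \<Rightarrow> 'b \<Rightarrow> 'a pmf" where
  "fiber q f c \<equiv> cond_pmf q {y. f y = c}"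

lemma set_fiber:
  assumes "c \<in> f ` set_pmf q"
  shows "set_pmf (fiber q f c) = {y \<in> set_pmf q. f y = c}"
proof -
  have "set_pmf q \<inter> {y. f y = c} \<noteq> {}" using assms by auto
  then show ?thesis by (auto simp: set_cond_pmf)
qed

lemma bind_fiber: "bind_pmf (map_pmf f q) (fiber q f) = q"
  by (rule bind_cond_pmf_cancel) (auto simp: vimage_def eq_commute)

text \<open>With \<open>\<rho> = exp (- a / 4)\<close>, \<open>8 / (1 - \<rho>)\<close> bounds
  \<open>2 ^ s\<close> times the mean collision probability, \<open>ln 2\<close> comes from the
  tangent bound, and 4 bounds the entropy at the coarse end of the window.\<close>

definition window_const :: "real \<Rightarrow> real" where
  "window_const a = 8 / ((1 - exp (- a / 4)) * ln 2) + 4"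

text \<open>Conditionally on \<open>X\<close> and on the cells of the copies of \<open>Y\<close>, the sum has collision probability of order
  \<open>2\<^sup>-\<^sup>s\<close> at scale \<open>r\<close>, while its standard deviation is at most \<open>2\<^sup>r\<^sup>+\<^sup>s\<close>, so its entropy at scale \<open>r + s\<close> is
  bounded.\<close>

lemma window_entropy:
  fixes p q :: "int pmf"
  defines "S \<equiv> \<lambda>s. pconv p (pconv_pow q (4 ^ s))"
  assumes fin: "finite (set_pmf p)" "finite (set_pmf q)" and a: "0 < a"
    and avg: "a * (2 ^ r)\<^sup>2 \<le> measure_pmf.expectation q (\<lambda>y. var_pmf (fiber q (\<lambda>y. y div 2 ^ r) (y div 2 ^ r)))"
  shows "real s - window_const a \<le> lev_ent (S s) r - lev_ent (S s) (r + s)"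
proof -
  let ?f = "\<lambda>y::int. y div 2 ^ r"
  define Q where "Q = map_pmf ?f q"
  define \<kappa> where "\<kappa> = fiber q ?f"
  define B L k :: nat where "B = 2 ^ r" and "L = 2 ^ s" and "k = 4 ^ s"
  define \<rho> where "\<rho> = exp (- a / 4)"
  have \<rho>: "0 \<le> \<rho>" "\<rho> < 1" using a by (auto simp: \<rho>_def)
  \<comment> \<open>Taking \<open>L ^ 2\<close> copies makes the standard deviation at most
    \<open>L * B = 2 ^ (r + s)\<close>.\<close>
  have kL: "k = L\<^sup>2" by (simp add: k_def L_def power_mult[symmetric] mult.commute[of s] power_mult)
  have BL: "0 < B" "0 < L" by (auto simp: B_def L_def)
  have finQ: "finite (set_pmf Q)" using fin by (simp add: Q_def)
  have set\<kappa>: "set_pmf (\<kappa> c) = {y \<in> set_pmf q. ?f y = c}" if "c \<in> set_pmf Q" for c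
    using that unfolding Q_def \<kappa>_def by (intro set_fiber) auto
  have fin\<kappa>: "finite (set_pmf (\<kappa> c))" if "c \<in> set_pmf Q" for c
    unfolding set\<kappa>[OF that] using fin by simp
  have diff: "\<bar>x - y\<bar> \<le> int B" if "c \<in> set_pmf Q" "x \<in> set_pmf (\<kappa> c)" "y \<in> set_pmf (\<kappa> c)" for c x y
  proof -
    have xy: "x div int B = c" "y div int B = c" using that by (auto simp: set\<kappa> B_def)
    have "0 \<le> x mod int B" "x mod int B < int B" "0 \<le> y mod int B" "y mod int B < int B"
      using BL by (auto intro: pos_mod_sign pos_mod_bound)
    moreover have "x = int B * c + x mod int B" "y = int B * c + y mod int B"
      using mult_div_mod_eq[of "int B" x] mult_div_mod_eq[of "int B" y] unfolding xy by auto
    ultimately show ?thesis by linarith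
  qed
  have q: "bind_pmf Q \<kappa> = q" unfolding Q_def \<kappa>_def by (rule bind_fiber)
  \<comment> \<open>\<open>V\<close> draws the value of \<open>X\<close> and the cells of the copies
    of \<open>Y\<close>; \<open>\<tau>\<close> is the conditional law of the sum.\<close>
  define V where "V = pair_pmf p (replicate_pmf k Q)"
  define \<tau> where "\<tau> = (\<lambda>(x, v). pconv (return_pmf x) (ksum \<kappa> v))"
  have finV: "finite (set_pmf V)" using fin finQ by (simp add: V_def)
  have vin: "set v \<subseteq> set_pmf Q" "length v = k" if "(x, v) \<in> set_pmf V" for x v
    using that by (auto simp: V_def set_replicate_pmf)
  have finl: "finite (set_pmf (\<tau> w))" if "w \<in> set_pmf V" for w
    using that vin by (auto simp: \<tau>_def split: prod.splits intro!: finite_set_pconv finite_set_ksum fin\<kappa>)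
  have S: "S s = bind_pmf V \<tau>"
    by (simp add: S_def k_def[symmetric] q[symmetric] bind_replicate_ksum[symmetric] V_def \<tau>_def
        pair_pmf_def bind_assoc_pmf bind_return_pmf pconv_bind)

  have upper: "ent (map_pmf (\<lambda>x. x div 2 ^ (r + s)) (\<tau> w)) \<le> 4" if w: "w \<in> set_pmf V" for w
  proof -
    obtain x v where xv: "w = (x, v)" by (cases w)
    note v = vin[OF w[unfolded xv]]
    have "var_pmf (\<tau> w) = var_pmf (ksum \<kappa> v)"
      using v by (simp add: xv \<tau>_def var_pmf_pconv finite_set_ksum fin\<kappa> subset_iff)
    also have "\<dots> \<le> real (length v) * (of_int (int B))\<^sup>2"
    proof (rule var_pmf_ksum_le)
      fix c assume "c \<in> set v"
      with v have c: "c \<in> set_pmf Q" by auto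
      then show "finite (set_pmf (\<kappa> c))" by (rule fin\<kappa>)
      show "var_pmf (\<kappa> c) \<le> (of_int (int B))\<^sup>2" by (rule var_pmf_le[OF fin\<kappa>[OF c] diff[OF c]])
    qed
    also have "\<dots> = (real (2 ^ (r + s)))\<^sup>2"
      using v by (simp add: kL B_def L_def power_add power_mult_distrib)
    finally have "ent (map_pmf (\<lambda>x. x div int (2 ^ (r + s))) (\<tau> w)) \<le> 4"
      by (intro ent_div_le_var finl w) auto
    then show ?thesis by simp
  qed

  have char_sq_bound: "measure_pmf.expectation V (\<lambda>w. char_sq (\<tau> w) ((real j - real j') / (real B * real L)))
      \<le> \<rho> ^ nat \<bar>int j' - int j\<bar>" if j: "j < L" "j' < L" for j j'
  proof -
    define t where "t = (real j - real j') / (real B * real L)"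
    have "\<bar>real j - real j'\<bar> \<le> real L" using j by linarith
    then have t: "\<bar>t\<bar> * real B \<le> 1" using BL by (simp add: t_def divide_simps)
    have "measure_pmf.expectation V (\<lambda>w. char_sq (\<tau> w) t)
       = measure_pmf.expectation (replicate_pmf k Q) (\<lambda>v. char_sq (ksum \<kappa> v) t)"
    proof -
      have "measure_pmf.expectation V (\<lambda>w. char_sq (\<tau> w) t) = measure_pmf.expectation V (\<lambda>w. char_sq (ksum \<kappa> (snd w)) t)"
        using vin by (intro expectation_cong) (auto simp: \<tau>_def char_sq_pconv finite_set_ksum fin\<kappa> subset_iff)
      then show ?thesis using fin finQ by (simp add: V_def expectation_pair_finite)
    qed
    also have "\<dots> = measure_pmf.expectation Q (\<lambda>c. char_sq (\<kappa> c) t) ^ k"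
      by (rule expectation_char_sq_ksum[OF finQ fin\<kappa>])
    also have "\<dots> \<le> exp (- (t\<^sup>2 * (a * (2 ^ r)\<^sup>2) / 4)) ^ k"
    proof (rule power_mono)
      \<comment> \<open>The average over cells sits inside the power, so a lower bound on the mean
        fiber variance is enough; no single fiber has to spread.\<close>
      have "measure_pmf.expectation Q (\<lambda>c. char_sq (\<kappa> c) t) \<le> measure_pmf.expectation Q (\<lambda>c. 1 - t\<^sup>2 / 4 * var_pmf (\<kappa> c))"
      proof (intro expectation_mono_finite finQ)
        fix c assume c: "c \<in> set_pmf Q"
        have "\<bar>t * of_int (x - y)\<bar> \<le> 1" if "x \<in> set_pmf (\<kappa> c)" "y \<in> set_pmf (\<kappa> c)" for x y
        proof -
          have "real_of_int \<bar>x - y\<bar> \<le> real_of_int (int B)"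
            using diff[OF c that] by (simp only: of_int_le_iff)
          then have "\<bar>t\<bar> * \<bar>of_int (x - y)\<bar> \<le> \<bar>t\<bar> * real B" by (intro mult_left_mono) auto
          with t show ?thesis by (simp add: abs_mult)
        qed
        from char_sq_le[OF fin\<kappa>[OF c] this] show "char_sq (\<kappa> c) t \<le> 1 - t\<^sup>2 / 4 * var_pmf (\<kappa> c)" by simp
      qed
      also have "\<dots> = 1 - t\<^sup>2 / 4 * measure_pmf.expectation Q (\<lambda>c. var_pmf (\<kappa> c))"
        by (subst expectation_diff_finite[OF finQ]) simp
      also have "\<dots> \<le> 1 - t\<^sup>2 / 4 * (a * (2 ^ r)\<^sup>2)"
        using avg by (intro diff_left_mono mult_left_mono) (auto simp: Q_def \<kappa>_def)
      also have "\<dots> \<le> exp (- (t\<^sup>2 * (a * (2 ^ r)\<^sup>2) / 4))"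
        using exp_ge_add_one_self[of "- (t\<^sup>2 * (a * (2 ^ r)\<^sup>2) / 4)"] by simp
      finally show "measure_pmf.expectation Q (\<lambda>c. char_sq (\<kappa> c) t) \<le> exp (- (t\<^sup>2 * (a * (2 ^ r)\<^sup>2) / 4))" .
      show "0 \<le> measure_pmf.expectation Q (\<lambda>c. char_sq (\<kappa> c) t)"
        by (intro integral_nonneg_AE) (simp add: char_sq_nonneg)
    qed
    also have "\<dots> = exp (- (real k * (t\<^sup>2 * (a * (2 ^ r)\<^sup>2) / 4)))" by (simp flip: exp_of_nat_mult)
    \<comment> \<open>The factors \<open>k = L ^ 2\<close> and \<open>B ^ 2\<close> cancel the
      denominator of \<open>t\<close>. Weakening the squared integer difference to its modulus then
      yields a geometric series.\<close>
    also have "real k * (t\<^sup>2 * (a * (2 ^ r)\<^sup>2) / 4) = a / 4 * (real j - real j')\<^sup>2"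
      using BL by (simp add: t_def kL B_def power_divide power_mult_distrib)
    also have "exp (- (a / 4 * (real j - real j')\<^sup>2)) \<le> exp (- (a / 4 * real (nat \<bar>int j' - int j\<bar>)))"
    proof -
      have "\<bar>int j' - int j\<bar> \<le> \<bar>int j' - int j\<bar>\<^sup>2" using self_le_power[of "\<bar>int j' - int j\<bar>" 2] by (cases "j = j'") auto
      then have "real_of_int \<bar>int j' - int j\<bar> \<le> (real j - real j')\<^sup>2"
        by (metis (no_types, lifting) of_int_le_iff of_int_power power2_abs of_int_diff of_int_of_nat_eq power2_commute)
      then show ?thesis using a by simp
    qed
    also have "\<dots> = \<rho> ^ nat \<bar>int j' - int j\<bar>"
      by (simp add: \<rho>_def mult.commute flip: exp_of_nat_mult)
    finally show ?thesis by (simp add: t_def)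
  qed

  have "(\<Sum>j<L. \<Sum>j'<L. measure_pmf.expectation V (\<lambda>w. char_sq (\<tau> w) ((real j - real j') / (real B * real L))))
     \<le> (\<Sum>j<L. \<Sum>j'<L. \<rho> ^ nat \<bar>int j' - int j\<bar>)"
    by (intro sum_mono char_sq_bound) auto
  also have "\<dots> \<le> (\<Sum>j<L. 2 / (1 - \<rho>))"
  proof (rule sum_mono)
    fix j
    have "(\<Sum>j'<L. \<rho> ^ nat \<bar>int j' - int j\<bar>) = (\<Sum>x\<in>int ` {..<L}. \<rho> ^ nat \<bar>x - int j\<bar>)"
      by (simp add: sum.reindex)
    also have "\<dots> \<le> 2 / (1 - \<rho>)" by (rule sum_power_dist_le) (use \<rho> in auto)
    finally show "(\<Sum>j'<L. \<rho> ^ nat \<bar>int j' - int j\<bar>) \<le> 2 / (1 - \<rho>)" .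
  qed
  finally have psum: "(\<Sum>j<L. \<Sum>j'<L. measure_pmf.expectation V (\<lambda>w. char_sq (\<tau> w) ((real j - real j') / (real B * real L))))
     \<le> real L * (2 / (1 - \<rho>))" by simp

  let ?collision = "\<lambda>w. collision (map_pmf ?f (\<tau> w))"
  have "measure_pmf.expectation V ?collision * ((real L)\<^sup>2 / 4)
     = measure_pmf.expectation V (\<lambda>w. ?collision w * (real L)\<^sup>2 / 4)" by simp
  also have "\<dots> \<le> measure_pmf.expectation V (\<lambda>w. \<Sum>j<L. \<Sum>j'<L. char_sq (\<tau> w) ((real j - real j') / (real B * real L)))"
    using collision_div_le[OF finl BL] by (intro expectation_mono_finite finV) (simp add: B_def)
  also have "\<dots> \<le> real L * (2 / (1 - \<rho>))"
    using psum by (simp only: Bochner_Integration.integral_sum integrable_measure_pmf_finite[OF finV])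
  finally have "real L * (real L * measure_pmf.expectation V ?collision) \<le> real L * (8 / (1 - \<rho>))"
    by (simp add: power2_eq_square mult_ac)
  then have "real L * measure_pmf.expectation V ?collision \<le> 8 / (1 - \<rho>)"
    using BL by (subst (asm) mult_le_cancel_left_pos) auto
  \<comment> \<open>The tangent bound is used with \<open>K = L\<close>, where
    \<open>log 2 L = s\<close>.\<close>
  then have "real s - 8 / ((1 - \<rho>) * ln 2) \<le> log 2 (real L) - (real L * measure_pmf.expectation V ?collision - 1) / ln 2"
    using divide_right_mono[of "real L * measure_pmf.expectation V ?collision - 1" "8 / (1 - \<rho>)" "ln 2"]
    by (simp add: L_def log_nat_power)
  then have "real s - window_const a \<le> log 2 (real L) - (real L * measure_pmf.expectation V ?collision - 1) / ln 2 - 4"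
    by (simp add: window_const_def \<rho>_def)
  also have "\<dots> = measure_pmf.expectation V (\<lambda>w. log 2 (real L) - (real L * ?collision w - 1) / ln 2 - 4)"
    by (simp add: expectation_diff_finite[OF finV])
  also have "\<dots> \<le> measure_pmf.expectation V (\<lambda>w. ent (map_pmf ?f (\<tau> w)) - ent (map_pmf (\<lambda>x. x div 2 ^ (r + s)) (\<tau> w)))"
  proof (intro expectation_mono_finite finV)
    fix w assume w: "w \<in> set_pmf V"
    have "log 2 (real L) - (real L * ?collision w - 1) / ln 2 \<le> ent (map_pmf ?f (\<tau> w))"
      by (rule ent_ge_collision) (use finl[OF w] BL in auto)
    with upper[OF w] show "log 2 (real L) - (real L * ?collision w - 1) / ln 2 - 4
      \<le> ent (map_pmf ?f (\<tau> w)) - ent (map_pmf (\<lambda>x. x div 2 ^ (r + s)) (\<tau> w))" by linarith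
  qed
  \<comment> \<open>Concavity of conditional entropy removes the conditioning on
    \<open>V\<close>.\<close>
  also have "\<dots> \<le> lev_ent (S s) r - lev_ent (S s) (r + s)"
    unfolding S lev_ent_def
    by (rule cond_ent_mixture[where a = "\<lambda>u. u div 2 ^ s", OF finV finl])
      (auto simp: zdiv_zmult2_eq power_add)
  finally show ?thesis .
qed

section \<open>Entropy across scales\<close>

lemma markov_finite:
  fixes f :: "'a \<Rightarrow> real"
  assumes fin: "finite (set_pmf p)" and nn: "\<And>x. x \<in> set_pmf p \<Longrightarrow> 0 \<le> f x"
  shows "c * measure_pmf.prob p {x. c \<le> f x} \<le> measure_pmf.expectation p f"
proof -
  have "c * measure_pmf.prob p {x. c \<le> f x} = measure_pmf.expectation p (\<lambda>x. c * indicat_real {x. c \<le> f x} x)"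
    by simp
  also have "\<dots> \<le> measure_pmf.expectation p f"
    by (intro expectation_mono_finite fin) (auto simp: indicator_def nn)
  finally show ?thesis .
qed

text \<open>Recording \<open>f x\<close> beside \<open>x\<close> costs no entropy and exhibits
  \<open>M\<close> as a labelled mixture of its fibers.\<close>

lemma ent_chain:
  assumes fin: "finite (set_pmf M)"
  shows "ent M = ent (map_pmf f M) + measure_pmf.expectation M (\<lambda>x. ent (fiber M f (f x)))"
proof -
  have "map_pmf (\<lambda>x. (x, f x)) M = bind_pmf (map_pmf f M) (\<lambda>c. map_pmf (\<lambda>x. (x, f x)) (fiber M f c))"
    by (subst bind_fiber[of f M, symmetric]) (rule map_bind_pmf)
  also have "\<dots> = bind_pmf (map_pmf f M) (\<lambda>c. map_pmf (\<lambda>x. (x, c)) (fiber M f c))"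
  proof (rule bind_pmf_cong[OF refl])
    fix c assume "c \<in> set_pmf (map_pmf f M)"
    then have "c \<in> f ` set_pmf M" by simp
    from set_fiber[OF this]
    show "map_pmf (\<lambda>x. (x, f x)) (fiber M f c) = map_pmf (\<lambda>x. (x, c)) (fiber M f c)"
      by (intro map_pmf_cong) auto
  qed
  finally have "ent (map_pmf (\<lambda>x. (x, f x)) M) = ent (map_pmf f M) + measure_pmf.expectation (map_pmf f M) (\<lambda>c. ent (fiber M f c))"
    using fin by (simp only:) (rule ent_mixture, auto simp: set_fiber)
  then show ?thesis
    using ent_map_inj[OF fin, of "\<lambda>x. (x, f x)"] by (simp add: inj_on_def)
qed

lemma ent_fiber_div_le:
  fixes M :: "int pmf"
  assumes "x \<in> set_pmf M"
  shows "ent (fiber M (\<lambda>a. a div 2 ^ m) (x div 2 ^ m)) \<le> real m"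
proof -
  let ?c = "x div 2 ^ m"
  have "set_pmf (fiber M (\<lambda>a. a div 2 ^ m) ?c) \<subseteq> {?c * 2 ^ m..<?c * 2 ^ m + 2 ^ m}"
  proof
    fix y assume "y \<in> set_pmf (fiber M (\<lambda>a. a div 2 ^ m) ?c)"
    then have "y div 2 ^ m = ?c" using assms by (subst (asm) set_fiber) auto
    then have "y = ?c * 2 ^ m + y mod 2 ^ m" using div_mult_mod_eq[of y "2 ^ m"] by simp
    moreover have "0 \<le> y mod 2 ^ m" "y mod 2 ^ m < 2 ^ m" by simp_all
    ultimately show "y \<in> {?c * 2 ^ m..<?c * 2 ^ m + 2 ^ m}"
      unfolding atLeastLessThan_iff by linarith
  qed
  from ent_le_card[OF _ this] show ?thesis by (simp add: nat_power_eq log_nat_power)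
qed

text \<open>Each window \<open>[r, r + s)\<close> starts at the least element of \<open>U\<close> not covered so far. It costs \<open>C\<close> by \<open>win\<close>, and
  the gap before it costs \<open>2\<close>.\<close>

lemma greedy_windows:
  fixes g h :: "nat \<Rightarrow> real" and U :: "nat set" and n m s :: nat
  assumes s: "0 < s"
    and gap: "\<And>a b. a \<le> b \<Longrightarrow> h a - h b - 2 \<le> g a - g b"
    and bound: "\<And>a. h a \<le> g a + 2"
    and win: "\<And>r. r \<in> U \<Longrightarrow> real s - C \<le> g r - g (r + s)"
  shows "\<exists>A w. finite A \<and> A \<subseteq> {a..} \<and> w * s < (n - a) + s
    \<and> (\<Sum>r\<in>A. 1 - (h r - h (Suc r))) \<le> g a - h a + 2 + (C + 2) * real w
    \<and> card {r \<in> U. a \<le> r \<and> r < n \<and> \<not> {r - m..<r} \<subseteq> A} \<le> m * w"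
proof (induction "n - a" arbitrary: a rule: less_induct)
  case less
  show ?case
  proof (cases "\<exists>r\<in>U. a \<le> r \<and> r < n")
    case False
    then have *: "{r \<in> U. a \<le> r \<and> r < n \<and> P r} = {}" for P by auto
    \<comment> \<open>No window is taken; \<open>bound\<close> makes \<open>g a - h a + 2\<close>
      non-negative.\<close>
    show ?thesis
      using s bound[of a] by (intro exI[of _ "{}"] exI[of _ 0]) (simp only: *, simp)
  next
    case True
    define r where "r = (LEAST r. r \<in> U \<and> a \<le> r \<and> r < n)"
    have r: "r \<in> U" "a \<le> r" "r < n"
      using LeastI_ex[of "\<lambda>r. r \<in> U \<and> a \<le> r \<and> r < n"] True unfolding r_def by auto
    have least: "r \<le> t" if "t \<in> U" "a \<le> t" "t < n" for t
      unfolding r_def using that by (intro Least_le) auto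
    have lt: "n - (r + s) < n - a" using r s by linarith
    obtain A w where A: "finite A" "A \<subseteq> {r + s..}" "w * s < (n - (r + s)) + s"
      and sum: "(\<Sum>r\<in>A. 1 - (h r - h (Suc r))) \<le> g (r + s) - h (r + s) + 2 + (C + 2) * real w"
      and card: "card {t \<in> U. r + s \<le> t \<and> t < n \<and> \<not> {t - m..<t} \<subseteq> A} \<le> m * w"
      using less[OF lt] by (elim exE conjE) (rule that; assumption)
    have "(\<Sum>j\<in>{r..<r + s}. h j - h (Suc j)) = h r - h (r + s)"
      by (induction s) auto
    then have win_sum: "(\<Sum>j\<in>{r..<r + s}. 1 - (h j - h (Suc j))) = real s - (h r - h (r + s))"
      by (simp add: sum_subtractf)
    have "(\<Sum>j\<in>{r..<r + s} \<union> A. 1 - (h j - h (Suc j)))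
       = real s - (h r - h (r + s)) + (\<Sum>j\<in>A. 1 - (h j - h (Suc j)))"
      using A by (subst sum.union_disjoint) (auto simp: win_sum)
    \<comment> \<open>By \<open>win\<close>, the length \<open>s\<close> is at most \<open>C\<close>
      plus the drop of \<open>g\<close> over the window; by \<open>gap\<close>, moving from
      \<open>a\<close> to \<open>r\<close> raises \<open>g - h\<close> by at most 2.\<close>
    also have "\<dots> \<le> g a - h a + 2 + (C + 2) * real (Suc w)"
      using sum win[OF r(1)] gap[OF r(2)] by (simp add: algebra_simps)
    finally have total: "(\<Sum>j\<in>{r..<r + s} \<union> A. 1 - (h j - h (Suc j))) \<le> g a - h a + 2 + (C + 2) * real (Suc w)" .
    \<comment> \<open>A point of the window at distance at least \<open>m\<close> from its start has
      its \<open>m\<close> predecessors inside, so each window spoils at most \<open>m\<close>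
      points.\<close>
    have "{t \<in> U. a \<le> t \<and> t < n \<and> \<not> {t - m..<t} \<subseteq> {r..<r + s} \<union> A}
       \<subseteq> {r..<r + m} \<union> {t \<in> U. r + s \<le> t \<and> t < n \<and> \<not> {t - m..<t} \<subseteq> A}"
    proof
      fix t assume t: "t \<in> {t \<in> U. a \<le> t \<and> t < n \<and> \<not> {t - m..<t} \<subseteq> {r..<r + s} \<union> A}"
      then have "r \<le> t" using least by auto
      moreover have "t < r + m" if "t < r + s"
      proof (rule ccontr)
        assume "\<not> t < r + m"
        then have "{t - m..<t} \<subseteq> {r..<r + s}" using that by auto
        with t show False by auto
      qed
      ultimately show "t \<in> {r..<r + m} \<union> {t \<in> U. r + s \<le> t \<and> t < n \<and> \<not> {t - m..<t} \<subseteq> A}"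
        using t by (cases "t < r + s") auto
    qed
    then have "card {t \<in> U. a \<le> t \<and> t < n \<and> \<not> {t - m..<t} \<subseteq> {r..<r + s} \<union> A}
       \<le> card ({r..<r + m} \<union> {t \<in> U. r + s \<le> t \<and> t < n \<and> \<not> {t - m..<t} \<subseteq> A})"
      by (intro card_mono) auto
    also have "\<dots> \<le> m + m * w"
      using card_Un_le[of "{r..<r + m}" "{t \<in> U. r + s \<le> t \<and> t < n \<and> \<not> {t - m..<t} \<subseteq> A}"] card by simp
    finally have bad: "card {t \<in> U. a \<le> t \<and> t < n \<and> \<not> {t - m..<t} \<subseteq> {r..<r + s} \<union> A} \<le> m * Suc w" by simp
    \<comment> \<open>Only the last window can reach beyond \<open>n\<close>, which accounts for the
      extra \<open>s\<close>.\<close>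
    have "Suc w * s < (n - a) + s"
    proof (cases "r + s \<le> n")
      case True
      then show ?thesis using A(3) r by simp
    next
      case False
      then have "w * s < 1 * s" using A(3) by simp
      then have "w = 0" using s by (simp only: mult_less_cancel2) simp
      then show ?thesis using r by simp
    qed
    then show ?thesis
      using total bad A r
      by (intro exI[of _ "{r..<r + s} \<union> A"] exI[of _ "Suc w"]) (simp, force)
  qed
qed

section \<open>Windows with small deficit, and averages over fibers\<close>

definition avg_fiber_var :: "int pmf \<Rightarrow> nat \<Rightarrow> real" where
  "avg_fiber_var q r = measure_pmf.expectation q (\<lambda>y. var_pmf (fiber q (\<lambda>y. y div 2 ^ r) (y div 2 ^ r)))"

text \<open>The greedy choice compares the level entropies of \<open>p\<close> with those of its sum
  with \<open>4 ^ s\<close> copies of \<open>q\<close>; the initial difference is controlled by the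
  gain from one copy.\<close>

lemma small_deficit_windows:
  fixes p q :: "int pmf" and n m s :: nat
  assumes fin: "finite (set_pmf p)" "finite (set_pmf q)" and supp: "set_pmf p \<subseteq> {0..2 ^ n}"
    and a: "0 < a" and s: "0 < s"
  shows "\<exists>A w. finite A \<and> w * s < n + s
    \<and> (\<Sum>r\<in>A. 1 - (lev_ent p r - lev_ent p (Suc r)))
        \<le> 4 ^ s * (ent (pconv p q) - ent p) + 2 + (window_const a + 2) * real w
    \<and> card {r. a * (2 ^ r)\<^sup>2 \<le> avg_fiber_var q r \<and> r < n \<and> \<not> {r - m..<r} \<subseteq> A} \<le> m * w"
proof -
  let ?S = "pconv p (pconv_pow q (4 ^ s))"
  let ?U = "{r. a * (2 ^ r)\<^sup>2 \<le> avg_fiber_var q r}"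
  have gap: "lev_ent p a - lev_ent p b - 2 \<le> lev_ent ?S a - lev_ent ?S b" if "a \<le> b" for a b
    using that fin by (intro lev_ent_pconv_diff) auto
  \<comment> \<open>The support may contain \<open>2 ^ n\<close> itself, so the entropy vanishes
    only strictly above scale \<open>n\<close>.\<close>
  have top: "lev_ent p r = 0" if "n < r" for r
  proof -
    have "map_pmf (\<lambda>x. x div 2 ^ r) p = map_pmf (\<lambda>x. 0) p"
    proof (rule map_pmf_cong[OF refl])
      fix x assume "x \<in> set_pmf p"
      with supp have "0 \<le> x" "x \<le> 2 ^ n" by auto
      moreover from \<open>x \<le> 2 ^ n\<close> have "x < 2 ^ r"
        by (rule order.strict_trans1) (use that in simp)
      ultimately show "x div 2 ^ r = 0" by (intro div_pos_pos_trivial)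
    qed
    then show ?thesis by (simp add: lev_ent_def)
  qed
  have bound: "lev_ent p a \<le> lev_ent ?S a + 2" for a
    using gap[of a "a + n + 1"] top[of "a + n + 1"] lev_ent_nonneg[of ?S "a + n + 1"] fin by simp
  have win: "real s - window_const a \<le> lev_ent ?S r - lev_ent ?S (r + s)" if "r \<in> ?U" for r
    using that unfolding avg_fiber_var_def by (intro window_entropy fin a) auto
  obtain A w where A: "finite A" "w * s < n + s"
     "(\<Sum>r\<in>A. 1 - (lev_ent p r - lev_ent p (Suc r))) \<le> lev_ent ?S 0 - lev_ent p 0 + 2 + (window_const a + 2) * real w"
     "card {r \<in> ?U. 0 \<le> r \<and> r < n \<and> \<not> {r - m..<r} \<subseteq> A} \<le> m * w"
    using greedy_windows[where h = "lev_ent p" and g = "lev_ent ?S" and a = 0 and n = n and m = m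
        and U = ?U, OF s gap bound win] by auto
  have "lev_ent ?S 0 - lev_ent p 0 \<le> 4 ^ s * (ent (pconv p q) - ent p)"
    using ent_pconv_pow_le[OF fin, of "4 ^ s"] by (simp add: lev_ent_def map_pmf_ident)
  with A show ?thesis by (intro exI[of _ A] exI[of _ w]) auto
qed

text \<open>Double counting: an index \<open>j\<close> precedes at most \<open>m\<close> elements of
  \<open>R\<close> by at most \<open>m\<close>.\<close>

lemma card_large_deficit:
  fixes d :: "nat \<Rightarrow> real"
  assumes A: "finite A" and d: "\<And>j. 0 \<le> d j" and m: "0 < m" and R: "finite R"
    and sub: "\<And>r. r \<in> R \<Longrightarrow> {r - m..<r} \<subseteq> A"
    and large: "\<And>r. r \<in> R \<Longrightarrow> real m * \<eta> \<le> (\<Sum>j\<in>{r - m..<r}. d j)"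
  shows "real (card R) * \<eta> \<le> (\<Sum>j\<in>A. d j)"
proof -
  have "real (card R) * (real m * \<eta>) = (\<Sum>r\<in>R. real m * \<eta>)" by simp
  also have "\<dots> \<le> (\<Sum>r\<in>R. \<Sum>j\<in>{r - m..<r}. d j)" by (intro sum_mono large)
  also have "\<dots> = (\<Sum>r\<in>R. \<Sum>j\<in>A. if j \<in> {r - m..<r} then d j else 0)"
    by (rule sum.cong[OF refl], subst sum.inter_restrict[OF A, symmetric]) (simp add: Int_absorb1 sub)
  also have "\<dots> = (\<Sum>j\<in>A. \<Sum>r\<in>R. if j \<in> {r - m..<r} then d j else 0)"
    by (rule sum.swap)
  also have "\<dots> = (\<Sum>j\<in>A. real (card {r \<in> R. j \<in> {r - m..<r}}) * d j)"
    using R by (intro sum.cong) (auto simp: sum.inter_filter[symmetric])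
  also have "\<dots> \<le> (\<Sum>j\<in>A. real m * d j)"
  proof (intro sum_mono mult_right_mono d)
    fix j
    have "card {r \<in> R. j \<in> {r - m..<r}} \<le> card {Suc j..<Suc j + m}"
      by (intro card_mono) auto
    then show "real (card {r \<in> R. j \<in> {r - m..<r}}) \<le> real m" by simp
  qed
  finally have "real m * (real (card R) * \<eta>) \<le> real m * (\<Sum>j\<in>A. d j)"
    by (simp add: sum_distrib_left mult.left_commute)
  then show ?thesis using m by (subst (asm) mult_le_cancel_left_pos) auto
qed

text \<open>The deficits telescope to \<open>m\<close> minus the mean entropy of the fibers. No
  fiber has entropy above \<open>m\<close>, so Markov's inequality applies to the defects at
  threshold \<open>m * \<epsilon>\<close>.\<close>

lemma prob_fiber_ent_gt:
  fixes p :: "int pmf"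
  assumes fin: "finite (set_pmf p)" and m: "0 < m" "m \<le> r" and \<epsilon>: "0 < \<epsilon>"
    and small: "(\<Sum>j\<in>{r - m..<r}. 1 - (lev_ent p j - lev_ent p (Suc j))) < real m * (\<epsilon> * \<epsilon>)"
  defines "M \<equiv> map_pmf (\<lambda>x. x div 2 ^ (r - m)) p"
  shows "1 - \<epsilon> < measure_pmf.prob M {x. 1 - \<epsilon> < ent (fiber M (\<lambda>a. a div 2 ^ m) (x div 2 ^ m)) / real m}"
proof -
  let ?e = "\<lambda>x. ent (fiber M (\<lambda>a. a div 2 ^ m) (x div 2 ^ m))"
  have finM: "finite (set_pmf M)" using fin by (simp add: M_def)
  have "x div 2 ^ r = x div 2 ^ (r - m) div 2 ^ m" for x :: int
    using m by (simp add: zdiv_zmult2_eq[symmetric] power_add[symmetric])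
  then have "lev_ent p r = ent (map_pmf (\<lambda>a. a div 2 ^ m) M)"
    by (simp add: lev_ent_def M_def map_pmf_comp)
  then have E: "lev_ent p (r - m) - lev_ent p r = measure_pmf.expectation M ?e"
    using ent_chain[OF finM, of "\<lambda>a. a div 2 ^ m"] by (simp add: lev_ent_def M_def)
  have "(\<Sum>j\<in>{r - m..<r}. lev_ent p j - lev_ent p (Suc j)) = lev_ent p (r - m) - lev_ent p r"
    using sum_Suc_diff'[of "r - m" r "\<lambda>j. - lev_ent p j"] m by simp
  then have "real m - measure_pmf.expectation M ?e < real m * (\<epsilon> * \<epsilon>)"
    using small m by (simp add: sum_subtractf E)
  moreover have "measure_pmf.expectation M (\<lambda>x. real m - ?e x) = real m - measure_pmf.expectation M ?e"
    by (simp add: expectation_diff_finite[OF finM])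
  moreover have "real m * \<epsilon> * measure_pmf.prob M {x. real m * \<epsilon> \<le> real m - ?e x} \<le> measure_pmf.expectation M (\<lambda>x. real m - ?e x)"
    using ent_fiber_div_le by (intro markov_finite finM) (simp add: algebra_simps)
  ultimately have "real m * \<epsilon> * measure_pmf.prob M {x. real m * \<epsilon> \<le> real m - ?e x} < real m * \<epsilon> * \<epsilon>"
    by simp
  then have "measure_pmf.prob M {x. real m * \<epsilon> \<le> real m - ?e x} < \<epsilon>"
    using m \<epsilon> by (subst (asm) mult_less_cancel_left_pos) auto
  moreover have "measure_pmf.prob M {x. real m * \<epsilon> \<le> real m - ?e x}
     = 1 - measure_pmf.prob M {x. 1 - \<epsilon> < ?e x / real m}"
  proof -
    have "{x. real m * \<epsilon> \<le> real m - ?e x} = UNIV - {x. 1 - \<epsilon> < ?e x / real m}"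
      using m by (auto simp: field_simps)
    then show ?thesis using measure_pmf.prob_compl[of "{x. 1 - \<epsilon> < ?e x / real m}" M] by simp
  qed
  ultimately show ?thesis by linarith
qed

lemma prob_fiber_var_lt:
  fixes q :: "int pmf"
  assumes fin: "finite (set_pmf q)" and \<sigma>: "0 < \<sigma>" and small: "avg_fiber_var q r < \<sigma> * \<epsilon> * (2 ^ r)\<^sup>2"
  shows "1 - \<epsilon> < measure_pmf.prob q {y. var_pmf (fiber q (\<lambda>y. y div 2 ^ r) (y div 2 ^ r)) < \<sigma> * (2 ^ r)\<^sup>2}"
proof -
  let ?v = "\<lambda>y. var_pmf (fiber q (\<lambda>y. y div 2 ^ r) (y div 2 ^ r))"
  have "\<sigma> * (2 ^ r)\<^sup>2 * measure_pmf.prob q {y. \<sigma> * (2 ^ r)\<^sup>2 \<le> ?v y} \<le> avg_fiber_var q r"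
    unfolding avg_fiber_var_def by (intro markov_finite fin var_pmf_nonneg)
  also have "\<dots> < \<sigma> * (2 ^ r)\<^sup>2 * \<epsilon>" using small by (simp add: mult_ac)
  finally have "measure_pmf.prob q {y. \<sigma> * (2 ^ r)\<^sup>2 \<le> ?v y} < \<epsilon>"
    using \<sigma> by (subst (asm) mult_less_cancel_left_pos) auto
  moreover have "{y. \<sigma> * (2 ^ r)\<^sup>2 \<le> ?v y} = UNIV - {y. ?v y < \<sigma> * (2 ^ r)\<^sup>2}" by auto
  ultimately show ?thesis
    using measure_pmf.prob_compl[of "{y. ?v y < \<sigma> * (2 ^ r)\<^sup>2}" q] by simp
qed

section \<open>Discretisation of Borel measures\<close>

text \<open>The push-forward as a \<open>pmf\<close>; countability of the target makes it
  discrete.\<close>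

definition law :: "'a measure \<Rightarrow> ('a \<Rightarrow> 'b::countable) \<Rightarrow> 'b pmf" where
  "law M X = Abs_pmf (distr M (count_space UNIV) X)"

context
  fixes M :: "'a measure" and X :: "'a \<Rightarrow> 'b::countable"
  assumes M: "prob_space M" and X: "X \<in> measurable M (count_space UNIV)"
begin

lemma measure_pmf_law: "measure_pmf (law M X) = distr M (count_space UNIV) X"
proof -
  interpret D: prob_space "distr M (count_space UNIV) X"
    by (rule prob_space.prob_space_distr[OF M X])
  have "AE x in distr M (count_space UNIV) X. measure (distr M (count_space UNIV) X) {x} \<noteq> 0"
    by (subst D.AE_support_countable) (auto intro!: exI[of _ UNIV])
  then show ?thesis unfolding law_def
    by (intro Abs_pmf_inverse) (simp add: D.prob_space_axioms)
qed

lemma measure_law: "measure_pmf.prob (law M X) A = measure M (X -` A \<inter> space M)"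
  unfolding measure_pmf_law by (rule measure_distr[OF X]) simp

lemma pmf_law: "pmf (law M X) i = measure M (X -` {i} \<inter> space M)"
  using measure_law[of "{i}"] by (simp add: measure_pmf_single)

lemma set_law: "set_pmf (law M X) \<subseteq> X ` space M"
proof
  fix i assume "i \<in> set_pmf (law M X)"
  then have "X -` {i} \<inter> space M \<noteq> {}" using pmf_law[of i] by (auto simp: set_pmf_iff)
  then show "i \<in> X ` space M" by auto
qed

end

lemma map_law:
  fixes f :: "'b::countable \<Rightarrow> 'c::countable"
  assumes M: "prob_space M" and X: "X \<in> measurable M (count_space UNIV)"
  shows "map_pmf f (law M X) = law M (\<lambda>x. f (X x))"
proof (rule pmf_eqI)
  fix i
  have fX: "(\<lambda>x. f (X x)) \<in> measurable M (count_space UNIV)"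
    using X by (rule measurable_compose) simp
  show "pmf (map_pmf f (law M X)) i = pmf (law M (\<lambda>x. f (X x))) i"
    by (simp add: pmf_map measure_law[OF M X] pmf_law[OF M fX] vimage_def)
qed

lemma law_distr:
  assumes M: "prob_space M" and Y: "Y \<in> measurable M N" and X: "X \<in> measurable N (count_space UNIV)"
  shows "law (distr M N Y) X = law M (\<lambda>x. X (Y x))"
  unfolding law_def by (simp add: distr_distr[OF X Y] comp_def)

lemma law_pair:
  fixes X :: "'a \<Rightarrow> 'b::countable" and Y :: "'c \<Rightarrow> 'd::countable"
  assumes M: "prob_space M" "prob_space N"
    and X: "X \<in> measurable M (count_space UNIV)" and Y: "Y \<in> measurable N (count_space UNIV)"
  shows "law (M \<Otimes>\<^sub>M N) (\<lambda>(x, y). (X x, Y y)) = pair_pmf (law M X) (law N Y)"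
proof (rule pmf_eqI)
  interpret M: prob_space M by fact
  interpret N: prob_space N by fact
  interpret P: pair_prob_space M N ..
  fix z :: "'b \<times> 'd"
  obtain i j where z: "z = (i, j)" by (cases z)
  have meas: "(\<lambda>(x, y). (X x, Y y)) \<in> measurable (M \<Otimes>\<^sub>M N) (count_space UNIV)"
    using X Y by measurable
  have "(\<lambda>(x, y). (X x, Y y)) -` {z} \<inter> space (M \<Otimes>\<^sub>M N) = (X -` {i} \<inter> space M) \<times> (Y -` {j} \<inter> space N)"
    by (auto simp: z space_pair_measure)
  moreover have "measure (M \<Otimes>\<^sub>M N) ((X -` {i} \<inter> space M) \<times> (Y -` {j} \<inter> space N))
     = measure M (X -` {i} \<inter> space M) * measure N (Y -` {j} \<inter> space N)"
    by (subst measure_def, subst N.emeasure_pair_measure_Times)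
      (use X Y in \<open>auto intro: measurable_sets simp: enn2real_mult measure_def\<close>)
  ultimately show "pmf (law (M \<Otimes>\<^sub>M N) (\<lambda>(x, y). (X x, Y y))) z = pmf (pair_pmf (law M X) (law N Y)) z"
    using pmf_law[OF P.prob_space_axioms meas, of z] by (simp add: z pmf_pair pmf_law M X Y)
qed

section \<open>Arithmetic of dyadic indices\<close>

lemma measurable_dyadic_index [measurable]: "dyadic_index n \<in> measurable borel (count_space UNIV)"
  unfolding dyadic_index_def by measurable

definition disc :: "nat \<Rightarrow> real measure \<Rightarrow> int pmf" where
  "disc n \<mu> = law \<mu> (dyadic_index n)"

lemma dyadic_cell_vimage: "dyadic_cell n j = dyadic_index n -` {j}"
  by (auto simp: mem_dyadic_cell_iff)

lemma dyadic_index_div: "dyadic_index (n + d) x div 2 ^ d = dyadic_index n x"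
  unfolding dyadic_index_def
  using floor_divide_real_eq_div[of "2 ^ d" "2 ^ (n + d) * x"] by (simp add: power_add)

lemma dyadic_index_rescale: "dyadic_index m (dyadic_rescale k c y) = dyadic_index (k + m) y - c * 2 ^ m"
proof -
  have "2 ^ m * dyadic_rescale k c y = 2 ^ (k + m) * y - of_int (c * 2 ^ m)"
    by (simp add: dyadic_rescale_def power_add algebra_simps)
  then show ?thesis unfolding dyadic_index_def by (simp only: floor_diff_of_int)
qed

lemma dyadic_index_add: "dyadic_index n (x + y) - (dyadic_index n x + dyadic_index n y) \<in> {0, 1}"
proof -
  have "2 ^ n * (x + y) = 2 ^ n * x + 2 ^ n * y" by (simp add: distrib_left)
  then have "dyadic_index n (x + y) = dyadic_index n x + dyadic_index n y
    \<or> dyadic_index n (x + y) = dyadic_index n x + dyadic_index n y + 1"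
    unfolding dyadic_index_def by linarith
  then show ?thesis by auto
qed

lemma inj_dyadic_cell: "inj (dyadic_cell n)"
proof (rule injI)
  fix i j assume "dyadic_cell n i = dyadic_cell n j"
  moreover have "of_int i / 2 ^ n \<in> dyadic_cell n i" by (simp add: dyadic_cell_def divide_strict_right_mono)
  ultimately have "dyadic_index n (of_int i / 2 ^ n) = i" "dyadic_index n (of_int i / 2 ^ n) = j"
    by (auto simp: mem_dyadic_cell_iff)
  then show "i = j" by simp
qed

section \<open>Components of a measure as fibers of its discretisation\<close>

context real_distribution
begin

lemma index_meas: "dyadic_index n \<in> measurable M (count_space UNIV)"
  by measurable

lemma prob_disc: "measure_pmf.prob (disc n M) A = prob (dyadic_index n -` A)"
  unfolding disc_def by (simp add: measure_law[OF prob_space_axioms index_meas])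

lemma pmf_disc: "pmf (disc n M) j = prob (dyadic_cell n j)"
  unfolding dyadic_cell_vimage prob_disc[symmetric] by (simp add: measure_pmf_single)

lemma map_disc: "map_pmf (\<lambda>j. j div 2 ^ d) (disc (n + d) M) = disc n M"
  unfolding disc_def by (subst map_law[OF prob_space_axioms index_meas]) (simp add: dyadic_index_div)

lemma dyadic_entropy_eq_ent:
  assumes fin: "finite (set_pmf (disc n M))"
  shows "dyadic_entropy n M = ent (disc n M)"
proof -
  have "(\<Sum>\<^sub>\<infinity>D\<in>dyadic_partition n. prob D * log 2 (prob D))
     = (\<Sum>\<^sub>\<infinity>j. pmf (disc n M) j * log 2 (pmf (disc n M) j))"
    unfolding dyadic_partition_def by (subst infsum_reindex[OF inj_dyadic_cell]) (simp add: comp_def pmf_disc)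
  \<comment> \<open>Null cells contribute \<open>0 * log 2 0 = 0\<close>.\<close>
  also have "\<dots> = (\<Sum>\<^sub>\<infinity>j\<in>set_pmf (disc n M). pmf (disc n M) j * log 2 (pmf (disc n M) j))"
    by (rule infsum_cong_neutral) (auto simp: set_pmf_iff)
  also have "\<dots> = (\<Sum>j\<in>set_pmf (disc n M). pmf (disc n M) j * log 2 (pmf (disc n M) j))"
    using fin by simp
  finally show ?thesis
    by (simp add: dyadic_entropy_def ent_def expectation_finite[OF fin] sum_negf)
qed

text \<open>Transfers a probability computed on indices to one about components: it is enough to
  check \<open>P\<close> at points whose level-\<open>N\<close> cell has positive mass.\<close>

lemma component_prob_ge:
  assumes "k \<le> N"
    and G: "\<And>x. dyadic_index N x \<in> set_pmf (disc N M) \<Longrightarrow> G (dyadic_index N x) \<Longrightarrow> P (rescaled_component M x k)"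
  shows "measure_pmf.prob (disc N M) {a. G a} \<le> component_prob M k P"
proof -
  let ?\<theta> = "\<lambda>c. distr (uniform_measure M (dyadic_cell k c)) borel (dyadic_rescale k c)"
  let ?T = "{c. prob (dyadic_cell k c) > 0 \<and> P (?\<theta> c)}"
  have "{x \<in> space M. prob (dyadic_cell_at k x) > 0 \<and> P (rescaled_component M x k)} = dyadic_index k -` ?T \<inter> space M"
    by (auto simp: dyadic_cell_at_def rescaled_component_def)
  then have meas: "{x \<in> space M. prob (dyadic_cell_at k x) > 0 \<and> P (rescaled_component M x k)} \<in> events"
    using index_meas[of k] by (simp del: space_eq_univ)
  \<comment> \<open>Restricting to the support guarantees that the level-\<open>k\<close> cell is
    not null, so the component is defined.\<close>
  have "measure_pmf.prob (disc N M) {a. G a} = measure_pmf.prob (disc N M) ({a. G a} \<inter> set_pmf (disc N M))"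
    by (simp add: measure_Int_set_pmf)
  also have "\<dots> = prob (dyadic_index N -` ({a. G a} \<inter> set_pmf (disc N M)))" by (rule prob_disc)
  also have "\<dots> \<le> component_prob M k P" unfolding component_prob_def
  proof (rule finite_measure_mono[OF _ meas], rule subsetI)
    fix x assume x: "x \<in> dyadic_index N -` ({a. G a} \<inter> set_pmf (disc N M))"
    have "set_pmf (disc k M) = (\<lambda>j. j div 2 ^ (N - k)) ` set_pmf (disc N M)"
      using arg_cong[OF map_disc[of "N - k" k], of set_pmf] \<open>k \<le> N\<close> by simp
    then have "dyadic_index N x div 2 ^ (N - k) \<in> set_pmf (disc k M)" using x by auto
    then have "dyadic_index k x \<in> set_pmf (disc k M)"
      using dyadic_index_div[of k "N - k" x] \<open>k \<le> N\<close> by simp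
    then have "0 < pmf (disc k M) (dyadic_index k x)" by (rule pmf_positive)
    then show "x \<in> {x \<in> space M. prob (dyadic_cell_at k x) > 0 \<and> P (rescaled_component M x k)}"
      using x G by (auto simp: pmf_disc dyadic_cell_at_def)
  qed
  finally show ?thesis .
qed

text \<open>Conditionally on the level-\<open>k\<close> cell of \<open>x\<close>, the
  level-\<open>N\<close> index has the fiber as its law. Only an inequality results because
  \<open>A\<close> may be larger than the rescaled part of the cell with index in
  \<open>B\<close>.\<close>

lemma measure_rescaled_component:
  assumes "k \<le> N" and x: "dyadic_index N x \<in> set_pmf (disc N M)" and A: "A \<in> sets borel"
    and BA: "\<And>y. dyadic_index k y = dyadic_index k x \<Longrightarrow> dyadic_index N y \<in> B
       \<Longrightarrow> dyadic_rescale k (dyadic_index k x) y \<in> A"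
  shows "measure_pmf.prob (fiber (disc N M) (\<lambda>a. a div 2 ^ (N - k)) (dyadic_index k x)) B
    \<le> measure (rescaled_component M x k) A"
proof -
  let ?c = "dyadic_index k x" and ?p = "disc N M"
  let ?D = "{a. a div 2 ^ (N - k) = ?c}"
  have idx: "dyadic_index N y div 2 ^ (N - k) = dyadic_index k y" for y
    using dyadic_index_div[of k "N - k" y] \<open>k \<le> N\<close> by simp
  have cell: "dyadic_cell k ?c = dyadic_index N -` ?D"
    by (auto simp: mem_dyadic_cell_iff idx)
  have ne: "set_pmf ?p \<inter> ?D \<noteq> {}" using x idx by auto
  have cellm: "dyadic_cell k ?c \<in> events" by (simp add: dyadic_cell_def)
  have pos: "0 < prob (dyadic_cell k ?c)"
    unfolding cell prob_disc[symmetric] by (rule measure_pmf_posI[OF x]) (simp add: idx)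
  have br: "dyadic_rescale k ?c \<in> borel_measurable borel"
    unfolding dyadic_rescale_def by measurable
  then have vm: "dyadic_rescale k ?c -` A \<in> events"
    using measurable_sets[OF br A] by simp
  have rm: "dyadic_rescale k ?c \<in> measurable (uniform_measure M (dyadic_cell k ?c)) borel"
    using br by (subst measurable_cong_sets[of _ borel _ borel]) auto
  have "measure_pmf.prob (fiber ?p (\<lambda>a. a div 2 ^ (N - k)) ?c) B
     = measure_pmf.prob ?p (?D \<inter> B) / measure_pmf.prob ?p ?D"
    unfolding cond_pmf.rep_eq[OF ne] by (subst measure_uniform_measure) (use ne in \<open>auto simp: measure_pmf.emeasure_eq_measure measure_measure_pmf_not_zero\<close>)
  also have "\<dots> = prob (dyadic_index N -` (?D \<inter> B)) / prob (dyadic_cell k ?c)"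
    by (simp add: prob_disc cell)
  also have "\<dots> \<le> prob (dyadic_cell k ?c \<inter> (dyadic_rescale k ?c -` A)) / prob (dyadic_cell k ?c)"
  proof (intro divide_right_mono finite_measure_mono)
    show "dyadic_index N -` (?D \<inter> B) \<subseteq> dyadic_cell k ?c \<inter> (dyadic_rescale k ?c -` A)"
      using BA by (auto simp: cell idx)
    show "dyadic_cell k ?c \<inter> (dyadic_rescale k ?c -` A) \<in> events" using cellm vm by (rule sets.Int)
  qed simp
  also have "\<dots> = measure (rescaled_component M x k) A"
    unfolding rescaled_component_def dyadic_cell_at_def
    by (subst measure_distr[OF rm A]) (use pos vm in \<open>simp add: emeasure_eq_measure\<close>)
  finally show ?thesis .
qed

text \<open>The right end is included because a point mass at 1 has index
  \<open>2 ^ n\<close>.\<close>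

lemma set_disc:
  assumes "prob {0..1} = 1"
  shows "set_pmf (disc n M) \<subseteq> {0..2 ^ n}"
proof
  fix j assume j: "j \<in> set_pmf (disc n M)"
  show "j \<in> {0..2 ^ n}"
  proof (rule ccontr)
    assume out: "j \<notin> {0..2 ^ n}"
    have "dyadic_index n -` {j} \<subseteq> space M - {0..1}"
    proof
      fix x assume "x \<in> dyadic_index n -` {j}"
      then have jx: "\<lfloor>2 ^ n * x\<rfloor> = j" by (simp add: dyadic_index_def)
      have False if "0 \<le> x" "x \<le> 1"
      proof -
        have "0 \<le> \<lfloor>2 ^ n * x\<rfloor>" using that by simp
        moreover have "2 ^ n * x \<le> of_int (2 ^ n)" using that by simp
        then have "\<lfloor>2 ^ n * x\<rfloor> \<le> 2 ^ n" by linarith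
        ultimately show False using out jx by simp
      qed
      then show "x \<in> space M - {0..1}" by auto
    qed
    then have "prob (dyadic_index n -` {j}) \<le> prob (space M - {0..1})"
      by (intro finite_measure_mono) auto
    also have "\<dots> = 0" using assms by (subst prob_compl) auto
    finally have "pmf (disc n M) j = 0"
      by (simp add: pmf_disc dyadic_cell_vimage measure_le_0_iff)
    then show False using j by (simp add: set_pmf_iff)
  qed
qed

lemma real_distribution_rescaled_component:
  assumes "0 < prob (dyadic_cell_at k x)"
  shows "real_distribution (rescaled_component M x k)"
proof -
  let ?\<theta> = "uniform_measure M (dyadic_cell_at k x)"
  interpret \<theta>: prob_space ?\<theta>
    by (rule prob_space_uniform_measure) (use assms in \<open>auto simp: emeasure_eq_measure\<close>)
  have "dyadic_rescale k c \<in> borel_measurable borel" for c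
    unfolding dyadic_rescale_def by measurable
  then have "dyadic_rescale k (dyadic_index k x) \<in> borel_measurable ?\<theta>"
    by (subst measurable_cong_sets[of _ borel _ borel]) auto
  then show ?thesis unfolding rescaled_component_def by (rule \<theta>.real_distribution_distr)
qed

lemma prob_cell_pos:
  assumes "k \<le> N" "dyadic_index N x \<in> set_pmf (disc N M)"
  shows "0 < prob (dyadic_cell_at k x)"
proof -
  have "dyadic_cell_at k x = dyadic_index N -` {a. a div 2 ^ (N - k) = dyadic_index k x}"
    using dyadic_index_div[of k "N - k"] \<open>k \<le> N\<close>
    by (auto simp: dyadic_cell_at_def mem_dyadic_cell_iff)
  then show ?thesis
    using measure_pmf_posI[OF assms(2), of "{a. a div 2 ^ (N - k) = dyadic_index k x}"]
      dyadic_index_div[of k "N - k" x] \<open>k \<le> N\<close>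
    by (simp add: prob_disc)
qed

text \<open>Cell by cell, the one-sided comparison bounds the right law by the left one; two
  different laws would violate it somewhere, as both have mass one.\<close>

lemma disc_rescaled_component:
  assumes x: "dyadic_index (k + m) x \<in> set_pmf (disc (k + m) M)"
  shows "disc m (rescaled_component M x k)
    = map_pmf (\<lambda>a. a - dyadic_index k x * 2 ^ m) (fiber (disc (k + m) M) (\<lambda>a. a div 2 ^ m) (dyadic_index k x))"
    (is "?L = ?R")
proof (rule ccontr)
  interpret \<theta>: real_distribution "rescaled_component M x k"
    by (intro real_distribution_rescaled_component prob_cell_pos[OF _ x]) simp
  assume ne: "?L \<noteq> ?R"
  have cell: "dyadic_cell m i \<in> sets borel" for i by (simp add: dyadic_cell_def)
  from pmf_neq_exists_less[OF ne] obtain i where i: "pmf ?L i < pmf ?R i" ..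
  have "measure_pmf.prob (fiber (disc (k + m) M) (\<lambda>a. a div 2 ^ (k + m - k)) (dyadic_index k x))
      {a. a - dyadic_index k x * 2 ^ m = i} \<le> measure (rescaled_component M x k) (dyadic_cell m i)"
    by (rule measure_rescaled_component[OF _ x cell]) (auto simp: mem_dyadic_cell_iff dyadic_index_rescale)
  then have "pmf ?R i \<le> pmf ?L i"
    by (simp add: pmf_map vimage_def \<theta>.pmf_disc)
  with i show False by simp
qed

text \<open>The component at level \<open>n - r\<close>, discretised to \<open>m\<close> digits, is
  a translate of a fiber and has the same entropy, so the deficits at the \<open>m\<close> scales
  below \<open>r\<close> control it.\<close>

lemma component_prob_uniform:
  assumes fin: "finite (set_pmf (disc n M))" and m: "0 < m" "m \<le> r" "r \<le> n" and \<epsilon>: "0 < \<epsilon>"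
    and small: "(\<Sum>j\<in>{r - m..<r}. 1 - (lev_ent (disc n M) j - lev_ent (disc n M) (Suc j))) < real m * (\<epsilon> * \<epsilon>)"
  shows "1 - \<epsilon> < component_prob M (n - r) (eps_uniform \<epsilon> m)"
proof -
  let ?k = "n - r"
  let ?M = "disc (?k + m) M"
  have M: "map_pmf (\<lambda>x. x div 2 ^ (r - m)) (disc n M) = ?M"
    using map_disc[of "r - m" "?k + m"] m by simp
  have finM: "finite (set_pmf ?M)" unfolding M[symmetric] using fin by simp
  have "1 - \<epsilon> < measure_pmf.prob ?M {x. 1 - \<epsilon> < ent (fiber ?M (\<lambda>a. a div 2 ^ m) (x div 2 ^ m)) / real m}"
    using prob_fiber_ent_gt[OF fin m(1,2) \<epsilon> small] unfolding M .
  also have "\<dots> \<le> component_prob M ?k (eps_uniform \<epsilon> m)"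
  proof (rule component_prob_ge)
    fix x assume x: "dyadic_index (?k + m) x \<in> set_pmf ?M"
      and gt: "1 - \<epsilon> < ent (fiber ?M (\<lambda>a. a div 2 ^ m) (dyadic_index (?k + m) x div 2 ^ m)) / real m"
    interpret \<theta>: real_distribution "rescaled_component M x ?k"
      by (intro real_distribution_rescaled_component prob_cell_pos[OF _ x]) simp
    let ?F = "fiber ?M (\<lambda>a. a div 2 ^ m) (dyadic_index ?k x)"
    have "dyadic_index ?k x \<in> (\<lambda>a. a div 2 ^ m) ` set_pmf ?M"
      using x dyadic_index_div[of ?k m x] by (metis image_eqI)
    from set_fiber[OF this] have finF: "finite (set_pmf ?F)" using finM by simp
    have "dyadic_entropy m (rescaled_component M x ?k) = ent ?F"
      using finF by (subst \<theta>.dyadic_entropy_eq_ent)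
        (auto simp: disc_rescaled_component[OF x] inj_on_def intro: ent_map_inj)
    then show "eps_uniform \<epsilon> m (rescaled_component M x ?k)"
      using gt by (simp add: eps_uniform_def norm_dyadic_entropy_def dyadic_index_div)
  qed simp
  finally show ?thesis .
qed

text \<open>By Chebyshev's inequality a fiber of small variance is concentrated on an interval of half the
  permitted length; the other half absorbs the discretisation error \<open>2 powr (- r)\<close>.\<close>

lemma component_prob_atomic:
  assumes fin: "finite (set_pmf (disc n M))" and r: "r \<le> n" "2 / \<epsilon> \<le> 2 ^ r" and \<epsilon>: "0 < \<epsilon>"
    and small: "avg_fiber_var (disc n M) r < \<epsilon> ^ 3 / 16 * \<epsilon> * (2 ^ r)\<^sup>2"
  shows "1 - \<epsilon> < component_prob M (n - r) (eps_atomic \<epsilon>)"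
proof -
  let ?k = "n - r" and ?q = "disc n M"
  let ?f = "\<lambda>y::int. y div 2 ^ r"
  have "1 - \<epsilon> < measure_pmf.prob ?q {y. var_pmf (fiber ?q ?f (?f y)) < \<epsilon> ^ 3 / 16 * (2 ^ r)\<^sup>2}"
    by (rule prob_fiber_var_lt[OF fin _ small]) (use \<epsilon> in simp)
  also have "\<dots> \<le> component_prob M ?k (eps_atomic \<epsilon>)"
  proof (rule component_prob_ge)
    fix x assume x: "dyadic_index n x \<in> set_pmf ?q"
      and v: "var_pmf (fiber ?q ?f (?f (dyadic_index n x))) < \<epsilon> ^ 3 / 16 * (2 ^ r)\<^sup>2"
    have fx: "?f (dyadic_index n x) = dyadic_index ?k x"
      using dyadic_index_div[of ?k r x] r by simp
    let ?c = "dyadic_index ?k x"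
    let ?F = "fiber ?q ?f ?c"
    have "?c \<in> ?f ` set_pmf ?q" using x fx by (metis image_eqI)
    from set_fiber[OF this] have finF: "finite (set_pmf ?F)" using fin by simp
    define \<mu> :: real where "\<mu> = measure_pmf.expectation ?F of_int"
    \<comment> \<open>After division by \<open>2 ^ r\<close> the interval of radius
      \<open>\<eta>\<close> has length \<open>\<epsilon> / 2\<close>, and
      \<open>\<epsilon> * \<eta> ^ 2\<close> is exactly the permitted variance.\<close>
    define \<eta> where "\<eta> = \<epsilon> / 4 * 2 ^ r"
    have \<eta>: "0 < \<eta>" using \<epsilon> by (simp add: \<eta>_def)
    define lo where "lo = (\<mu> - \<eta>) / 2 ^ r - of_int ?c"
    have "measure_pmf.prob ?F {y. \<eta>\<^sup>2 \<le> (of_int y - \<mu>)\<^sup>2} * \<eta>\<^sup>2 \<le> var_pmf ?F"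
      using markov_finite[OF finF, of "\<lambda>y. (of_int y - \<mu>)\<^sup>2" "\<eta>\<^sup>2"]
      by (simp add: var_pmf_def \<mu>_def mult.commute)
    also have "\<dots> < \<epsilon> * \<eta>\<^sup>2"
    proof -
      have "\<epsilon> * \<eta>\<^sup>2 = \<epsilon> ^ 3 / 16 * (2 ^ r)\<^sup>2"
        unfolding \<eta>_def power_mult_distrib power_divide by (simp add: power3_eq_cube power2_eq_square)
      with v show ?thesis by (simp only: fx)
    qed
    finally have "measure_pmf.prob ?F {y. \<eta>\<^sup>2 \<le> (of_int y - \<mu>)\<^sup>2} < \<epsilon>"
      using \<eta> by (subst (asm) mult_less_cancel_right_pos) auto
    moreover have "{y::int. \<eta>\<^sup>2 \<le> (of_int y - \<mu>)\<^sup>2} = UNIV - {y. \<bar>of_int y - \<mu>\<bar> < \<eta>}"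
      using \<eta> by (auto simp: abs_le_square_iff[symmetric] not_less)
    ultimately have "1 - \<epsilon> < measure_pmf.prob ?F {y. \<bar>of_int y - \<mu>\<bar> < \<eta>}"
      using measure_pmf.prob_compl[of "{y::int. \<bar>of_int y - \<mu>\<bar> < \<eta>}" ?F] by simp
    also have "\<dots> \<le> measure (rescaled_component M x ?k) {lo..lo + \<epsilon>}"
    proof -
      have "measure_pmf.prob (fiber ?q (\<lambda>a. a div 2 ^ (n - ?k)) ?c) {y. \<bar>of_int y - \<mu>\<bar> < \<eta>}
         \<le> measure (rescaled_component M x ?k) {lo..lo + \<epsilon>}"
      proof (rule measure_rescaled_component[OF _ x])
        fix y assume "dyadic_index ?k y = ?c" "dyadic_index n y \<in> {y. \<bar>of_int y - \<mu>\<bar> < \<eta>}"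
        then have Y: "\<bar>of_int (dyadic_index n y) - \<mu>\<bar> < \<eta>" by simp
        \<comment> \<open>Replacing the index by the real point moves it up by less than 1, hence
          the extra 1 in the upper bound.\<close>
        have "of_int (dyadic_index n y) \<le> 2 ^ n * y" "2 ^ n * y < of_int (dyadic_index n y) + 1"
          unfolding dyadic_index_def by linarith+
        with Y have b: "\<mu> - \<eta> \<le> 2 ^ n * y" "2 ^ n * y \<le> \<mu> + \<eta> + 1" by linarith+
        have n: "(2::real) ^ n = 2 ^ ?k * 2 ^ r" using r by (simp flip: power_add)
        have "(\<mu> - \<eta>) / 2 ^ r \<le> 2 ^ ?k * y"
          using b(1) unfolding n by (simp add: divide_le_eq mult_ac)
        moreover have "2 ^ ?k * y \<le> (\<mu> + \<eta> + 1) / 2 ^ r"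
          using b(2) unfolding n by (simp add: le_divide_eq mult_ac)
        moreover have "(\<mu> + \<eta> + 1) / 2 ^ r \<le> (\<mu> - \<eta>) / 2 ^ r + \<epsilon>"
        proof -
          have "1 / 2 ^ r \<le> \<epsilon> / 2" using r(2) \<epsilon> by (simp add: field_simps)
          moreover have "(\<mu> + \<eta> + 1) / 2 ^ r = (\<mu> - \<eta>) / 2 ^ r + \<epsilon> / 2 + 1 / 2 ^ r"
            by (simp add: \<eta>_def field_simps)
          ultimately show ?thesis by linarith
        qed
        ultimately show "dyadic_rescale ?k ?c y \<in> {lo..lo + \<epsilon>}"
          unfolding dyadic_rescale_def lo_def atLeastAtMost_iff by linarith
      qed auto
      then show ?thesis using r by simp
    qed
    finally have "1 - \<epsilon> < measure (rescaled_component M x ?k) {lo..lo + \<epsilon>}" .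
    then show "eps_atomic \<epsilon> (rescaled_component M x ?k)"
      unfolding eps_atomic_def using \<epsilon> by (intro exI[of _ "{lo..lo + \<epsilon>}"]) (auto simp: is_interval_cc)
  qed simp
  finally show ?thesis .
qed

end

text \<open>The index of a sum exceeds the sum of the indices by 0 or 1, which costs one
  bit.\<close>

lemma ent_pconv_disc_le:
  assumes \<mu>: "real_distribution \<mu>" "measure \<mu> {0..1} = 1" and \<nu>: "real_distribution \<nu>" "measure \<nu> {0..1} = 1"
  shows "ent (pconv (disc n \<mu>) (disc n \<nu>)) \<le> dyadic_entropy n (\<mu> \<star> \<nu>) + 1"
proof -
  interpret M: real_distribution \<mu> by (rule \<mu>(1))
  interpret N: real_distribution \<nu> by (rule \<nu>(1))
  interpret P: pair_prob_space \<mu> \<nu> ..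
  let ?i = "dyadic_index n"
  have add: "(\<lambda>(x, y). x + y) \<in> borel_measurable (\<mu> \<Otimes>\<^sub>M \<nu>)" by measurable
  have C: "real_distribution (\<mu> \<star> \<nu>)"
    unfolding convolution_def by (rule P.real_distribution_distr[OF add])
  interpret C: real_distribution "\<mu> \<star> \<nu>" by (rule C)
  \<comment> \<open>Both quantities are read off one joint law, so that they can be compared
    pointwise.\<close>
  define X where "X = (\<lambda>(x, y). ((?i x, ?i y), ?i (x + y)))"
  have X: "X \<in> measurable (\<mu> \<Otimes>\<^sub>M \<nu>) (count_space UNIV)"
    unfolding X_def by measurable
  define J where "J = law (\<mu> \<Otimes>\<^sub>M \<nu>) X"
  have fst: "map_pmf fst J = pair_pmf (disc n \<mu>) (disc n \<nu>)"
    unfolding J_def map_law[OF P.prob_space_axioms X]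
    using law_pair[OF M.prob_space_axioms N.prob_space_axioms M.index_meas N.index_meas, of n n]
    by (simp add: X_def case_prod_unfold disc_def)
  have snd: "map_pmf snd J = disc n (\<mu> \<star> \<nu>)"
    unfolding J_def map_law[OF P.prob_space_axioms X] disc_def convolution_def
    by (subst law_distr[OF P.prob_space_axioms add measurable_dyadic_index])
      (simp add: X_def case_prod_unfold)
  have J: "snd z - (fst (fst z) + snd (fst z)) \<in> {0, 1}" if "z \<in> set_pmf J" for z
  proof -
    have "z \<in> range X" using that set_law[OF P.prob_space_axioms X] by (auto simp: J_def)
    then obtain x y where "z = X (x, y)" by auto
    then show ?thesis using dyadic_index_add[of n x y] by (simp only: X_def prod.case fst_conv snd_conv)
  qed
  have finD: "finite (set_pmf (disc n \<mu>))" "finite (set_pmf (disc n \<nu>))"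
    using finite_subset[OF M.set_disc[OF \<mu>(2)]] finite_subset[OF N.set_disc[OF \<nu>(2)]] by simp_all
  have "set_pmf J \<subseteq> (\<lambda>((i, j), d). ((i, j), i + j + d)) ` ((set_pmf (disc n \<mu>) \<times> set_pmf (disc n \<nu>)) \<times> {0, 1})"
  proof
    fix z assume z: "z \<in> set_pmf J"
    obtain i j k where ijk: "z = ((i, j), k)" by (cases z) auto
    have "(i, j) \<in> set_pmf (map_pmf fst J)" using z ijk by force
    moreover have "k - (i + j) \<in> {0, 1}" using J[OF z] ijk by simp
    ultimately show "z \<in> (\<lambda>((i, j), d). ((i, j), i + j + d)) ` ((set_pmf (disc n \<mu>) \<times> set_pmf (disc n \<nu>)) \<times> {0, 1})"
      unfolding fst using ijk by (intro image_eqI[of _ _ "((i, j), k - (i + j))"]) auto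
  qed
  then have finJ: "finite (set_pmf J)" by (rule finite_subset) (use finD in simp)
  have "pconv (disc n \<mu>) (disc n \<nu>) = map_pmf (\<lambda>z. fst (fst z) + snd (fst z)) J"
    by (simp add: pconv_def fst[symmetric] map_pmf_comp case_prod_unfold)
  then have "ent (pconv (disc n \<mu>) (disc n \<nu>)) \<le> ent (disc n (\<mu> \<star> \<nu>)) + 1"
    using ent_floor_shift[OF finJ, of snd "\<lambda>z. fst (fst z) + snd (fst z)" 0] J snd by simp
  also have "ent (disc n (\<mu> \<star> \<nu>)) = dyadic_entropy n (\<mu> \<star> \<nu>)"
    by (subst C.dyadic_entropy_eq_ent) (use finJ in \<open>auto simp flip: snd\<close>)
  finally show ?thesis .
qed

section \<open>Choice of parameters and counting of the good scales\<close>

theorem theorem2p7: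
  fixes \<epsilon> :: real and m :: nat
  assumes "\<epsilon> > 0" and "m \<ge> 1"
  shows "\<exists>\<delta>>0. \<exists>N. \<forall>n>N. \<forall>\<mu>\<in>borel_probs {0..1}. \<forall>\<nu>\<in>borel_probs {0..1}.
    norm_dyadic_entropy n (\<mu> \<star> \<nu>) < norm_dyadic_entropy n \<mu> + \<delta> \<longrightarrow>
    (\<exists>I J. I \<subseteq> {1..n} \<and> J \<subseteq> {1..n} \<and> I \<inter> J = {} \<and>
       real (card (I \<union> J)) > (1 - \<epsilon>) * real n \<and>
       (\<forall>k\<in>I. component_prob \<mu> k (eps_uniform \<epsilon> m) > 1 - \<epsilon>) \<and>
       (\<forall>k\<in>J. component_prob \<nu> k (eps_atomic \<epsilon>) > 1 - \<epsilon>))"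
proof -
  \<comment> \<open>Markov's inequality turns a mean defect of
    \<open>\<epsilon> * \<epsilon>\<close> per digit into a defect \<open>\<epsilon>\<close> outside
    probability \<open>\<epsilon>\<close>; likewise \<open>a\<close> is the Chebyshev variance
    \<open>\<epsilon> ^ 3 / 16\<close> times \<open>\<epsilon>\<close>.\<close>
  define \<eta> where "\<eta> = \<epsilon> * \<epsilon>"
  define a where "a = \<epsilon> ^ 3 / 16 * \<epsilon>"
  define C where "C = window_const a + 2"
  have \<eta>: "0 < \<eta>" and a: "0 < a" using assms by (simp_all add: \<eta>_def a_def)
  have C: "0 < C" using a by (simp add: C_def window_const_def add_nonneg_pos)
  \<comment> \<open>Each of the roughly \<open>n / s\<close> windows spoils \<open>m\<close> scales
    and costs deficit \<open>C\<close>; long windows reduce this to a proportion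
    \<open>\<epsilon> / 4\<close> of all scales.\<close>
  obtain s0 :: nat where s0: "(real m + C / \<eta>) * 4 / \<epsilon> \<le> real s0"
    using real_arch_simple by blast
  define s where "s = Suc s0"
  have s: "0 < s" "(real m + C / \<eta>) / real s \<le> \<epsilon> / 4"
    using s0 assms by (simp_all add: s_def field_simps)
  obtain c :: nat where c: "2 / \<epsilon> \<le> real c" using real_arch_simple by blast
  \<comment> \<open>\<open>K\<close> collects the losses independent of \<open>n\<close>: the
    excluded lowest scales, one extra window, and the additive constants, including one rounding bit
    multiplied by the \<open>4 ^ s\<close> copies.\<close>
  define K where "K = real c + 2 * real m + (4 ^ s + 2 + C) / \<eta>"
  \<comment> \<open>Chosen so that the amplified entropy gain \<open>4 ^ s * n * \<delta>\<close>
    accounts for at most \<open>\<epsilon> / 4 * n\<close> scales of large deficit.\<close>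
  define \<delta> where "\<delta> = \<eta> * \<epsilon> / (4 * 4 ^ s)"
  have \<delta>: "0 < \<delta>" using \<eta> assms by (simp add: \<delta>_def)
  obtain N :: nat where N: "4 * K / \<epsilon> \<le> real N" using real_arch_simple by blast
  show ?thesis
  proof (intro exI[of _ \<delta>] conjI \<delta> exI[of _ N] allI ballI impI)
    fix n \<mu> \<nu>
    assume n: "N < n" and "\<mu> \<in> borel_probs {0..1}" "\<nu> \<in> borel_probs {0..1}"
      and small: "norm_dyadic_entropy n (\<mu> \<star> \<nu>) < norm_dyadic_entropy n \<mu> + \<delta>"
    then have \<mu>: "real_distribution \<mu>" "measure \<mu> {0..1} = 1" and \<nu>: "real_distribution \<nu>" "measure \<nu> {0..1} = 1"
      by (auto simp: borel_probs_def)
    interpret M: real_distribution \<mu> by (rule \<mu>(1))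
    interpret N: real_distribution \<nu> by (rule \<nu>(1))
    have n0: "0 < real n" using n by simp
    have Kn: "K \<le> \<epsilon> / 4 * real n"
    proof -
      have "4 * K / \<epsilon> \<le> real n" using N n by linarith
      then show ?thesis using assms by (simp add: field_simps)
    qed
    define p where "p = disc n \<mu>"
    define q where "q = disc n \<nu>"
    have supp: "set_pmf p \<subseteq> {0..2 ^ n}" "set_pmf q \<subseteq> {0..2 ^ n}"
      unfolding p_def q_def by (rule M.set_disc[OF \<mu>(2)] N.set_disc[OF \<nu>(2)])+
    then have fin: "finite (set_pmf p)" "finite (set_pmf q)" by (auto dest: finite_subset)
    have "ent (pconv p q) \<le> dyadic_entropy n (\<mu> \<star> \<nu>) + 1"
      unfolding p_def q_def by (rule ent_pconv_disc_le[OF \<mu> \<nu>])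
    also have "dyadic_entropy n (\<mu> \<star> \<nu>) < dyadic_entropy n \<mu> + real n * \<delta>"
      using small n0 by (simp add: norm_dyadic_entropy_def field_simps)
    also have "dyadic_entropy n \<mu> = ent p"
      unfolding p_def by (rule M.dyadic_entropy_eq_ent) (use fin in \<open>simp add: p_def\<close>)
    finally have gain: "ent (pconv p q) - ent p \<le> real n * \<delta> + 1" by simp
    obtain A w where A: "finite A" "w * s < n + s"
        "(\<Sum>r\<in>A. 1 - (lev_ent p r - lev_ent p (Suc r))) \<le> 4 ^ s * (ent (pconv p q) - ent p) + 2 + C * real w"
        "card {r. a * (2 ^ r)\<^sup>2 \<le> avg_fiber_var q r \<and> r < n \<and> \<not> {r - m..<r} \<subseteq> A} \<le> m * w"
      using small_deficit_windows[OF fin supp(1) a s(1), of m] unfolding C_def by auto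
    define d where "d j = 1 - (lev_ent p j - lev_ent p (Suc j))" for j
    have d: "0 \<le> d j" for j using lev_ent_step_le[OF fin(1)] by (simp add: d_def)
    have w: "real w \<le> real n / real s + 1"
    proof -
      have "real (w * s) < real (n + s)" using A(2) by (simp only: of_nat_less_iff)
      then show ?thesis using s(1) by (simp add: field_simps)
    qed
    have "(\<Sum>j\<in>A. d j) \<le> 4 ^ s * (real n * \<delta> + 1) + 2 + C * (real n / real s + 1)"
      unfolding d_def
      by (rule order_trans[OF A(3)]) (intro add_mono mult_left_mono gain w order_refl, use C in auto)
    then have sumA: "(\<Sum>j\<in>A. d j) / \<eta> \<le> (4 ^ s * (real n * \<delta> + 1) + 2 + C * (real n / real s + 1)) / \<eta>"
      using \<eta> by (intro divide_right_mono) auto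

    let ?D = "\<lambda>r. \<Sum>j\<in>{r - m..<r}. d j"
    let ?U = "{r. a * (2 ^ r)\<^sup>2 \<le> avg_fiber_var q r}"
    \<comment> \<open>From \<open>c\<close> on, \<open>2 / \<epsilon> \<le> 2 ^ r\<close> holds, and
      from \<open>m\<close> on there are \<open>m\<close> scales below \<open>r\<close>.\<close>
    define R where "R = {max c m..<n}"
    \<comment> \<open>\<open>T1\<close> and \<open>T2\<close> will give the uniform and the atomic
      levels. The remaining scales of \<open>R\<close> are either not covered by windows
      (\<open>B1\<close>) or covered with large deficit (\<open>B2\<close>).\<close>
    define T1 where "T1 = {r \<in> R. r \<in> ?U \<and> ?D r < real m * \<eta>}"
    define T2 where "T2 = R - ?U"
    define B1 where "B1 = {r. a * (2 ^ r)\<^sup>2 \<le> avg_fiber_var q r \<and> r < n \<and> \<not> {r - m..<r} \<subseteq> A}"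
    define B2 where "B2 = {r \<in> R. {r - m..<r} \<subseteq> A \<and> real m * \<eta> \<le> ?D r}"
    have "real (card B2) * \<eta> \<le> (\<Sum>j\<in>A. d j)"
      by (rule card_large_deficit[where m = m, OF A(1) d]) (use assms in \<open>auto simp: B2_def R_def\<close>)
    then have B2: "real (card B2) \<le> (\<Sum>j\<in>A. d j) / \<eta>" using \<eta> by (simp add: le_divide_eq)
    have B1: "real (card B1) \<le> real m * (real n / real s + 1)"
    proof -
      have "real (card B1) \<le> real (m * w)" using A(4) unfolding B1_def by (simp only: of_nat_le_iff)
      also have "\<dots> \<le> real m * (real n / real s + 1)" using w by (simp add: mult_left_mono)
      finally show ?thesis .
    qed
    have "R \<subseteq> (T1 \<union> T2) \<union> (B1 \<union> B2)"
      by (auto simp: T1_def T2_def B1_def B2_def R_def not_less)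
    moreover have "finite (T1 \<union> T2 \<union> (B1 \<union> B2))"
      by (auto simp: T1_def T2_def B1_def B2_def R_def)
    ultimately have "card R \<le> card ((T1 \<union> T2) \<union> (B1 \<union> B2))" by (intro card_mono)
    also have "\<dots> \<le> card (T1 \<union> T2) + (card B1 + card B2)"
      using card_Un_le[of "T1 \<union> T2" "B1 \<union> B2"] card_Un_le[of B1 B2] by linarith
    finally have cR: "n - max c m \<le> card (T1 \<union> T2) + (card B1 + card B2)" by (simp add: R_def)
    have "real n - real c - real m \<le> real (n - max c m)" by simp
    also have "\<dots> \<le> real (card (T1 \<union> T2) + (card B1 + card B2))" using cR by (simp only: of_nat_le_iff)
    also have "\<dots> \<le> real (card (T1 \<union> T2)) + (real m * (real n / real s + 1)
        + (4 ^ s * (real n * \<delta> + 1) + 2 + C * (real n / real s + 1)) / \<eta>)"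
      using B1 B2 sumA by simp
    finally have "real n - (real c + real m + (real m * (real n / real s + 1)
        + (4 ^ s * (real n * \<delta> + 1) + 2 + C * (real n / real s + 1)) / \<eta>)) \<le> real (card (T1 \<union> T2))"
      by linarith
    also have "real c + real m + (real m * (real n / real s + 1)
        + (4 ^ s * (real n * \<delta> + 1) + 2 + C * (real n / real s + 1)) / \<eta>)
      = K + real n * ((real m + C / \<eta>) / real s) + 4 ^ s * \<delta> / \<eta> * real n"
      using \<eta> s(1) by (simp add: K_def field_simps)
    finally have T: "real n - (K + real n * ((real m + C / \<eta>) / real s) + 4 ^ s * \<delta> / \<eta> * real n)
      \<le> real (card (T1 \<union> T2))" .
    have eq: "4 ^ s * \<delta> / \<eta> = \<epsilon> / 4" using \<eta> by (simp add: \<delta>_def)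
    have "real n * ((real m + C / \<eta>) / real s) \<le> \<epsilon> / 4 * real n"
      using mult_left_mono[OF s(2), of "real n"] by (simp add: mult.commute)
    \<comment> \<open>Three losses of \<open>\<epsilon> / 4 * n\<close> leave a further quarter,
      which gives the strict inequality.\<close>
    then have "real n - (\<epsilon> / 4 * real n + \<epsilon> / 4 * real n + \<epsilon> / 4 * real n) \<le> real (card (T1 \<union> T2))"
      using T[unfolded eq] Kn by linarith
    moreover have "0 < \<epsilon> * real n" using assms n0 by simp
    ultimately have card_T: "(1 - \<epsilon>) * real n < real (card (T1 \<union> T2))"
      by (simp add: left_diff_distrib)

    \<comment> \<open>Scale \<open>r\<close> corresponds to level \<open>n - r\<close>, which is at
      least 1 because \<open>r < n\<close> on \<open>R\<close>.\<close>
    let ?f = "\<lambda>r. n - r"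
    have inj: "inj_on ?f (T1 \<union> T2)" by (auto simp: inj_on_def T1_def T2_def R_def)
    show "\<exists>I J. I \<subseteq> {1..n} \<and> J \<subseteq> {1..n} \<and> I \<inter> J = {} \<and>
       real (card (I \<union> J)) > (1 - \<epsilon>) * real n \<and>
       (\<forall>k\<in>I. component_prob \<mu> k (eps_uniform \<epsilon> m) > 1 - \<epsilon>) \<and>
       (\<forall>k\<in>J. component_prob \<nu> k (eps_atomic \<epsilon>) > 1 - \<epsilon>)"
    proof (rule exI[of _ "?f ` T1"], rule exI[of _ "?f ` T2"], intro conjI ballI)
      show "?f ` T1 \<subseteq> {1..n}" "?f ` T2 \<subseteq> {1..n}" by (auto simp: T1_def T2_def R_def)
      have "?f ` T1 \<inter> ?f ` T2 = ?f ` (T1 \<inter> T2)"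
        by (rule inj_on_image_Int[OF inj, symmetric]) auto
      also have "T1 \<inter> T2 = {}" by (auto simp: T1_def T2_def)
      finally show "?f ` T1 \<inter> ?f ` T2 = {}" by simp
      show "real (card (?f ` T1 \<union> ?f ` T2)) > (1 - \<epsilon>) * real n"
        using card_T card_image[OF inj] by (simp add: image_Un)
    next
      fix k assume "k \<in> ?f ` T1"
      then obtain r where r: "r \<in> T1" "k = n - r" by auto
      then show "component_prob \<mu> k (eps_uniform \<epsilon> m) > 1 - \<epsilon>"
        unfolding r(2) using assms fin
        by (intro M.component_prob_uniform) (auto simp: T1_def R_def p_def \<eta>_def d_def)
    next
      fix k assume "k \<in> ?f ` T2"
      then obtain r where r: "r \<in> T2" "k = n - r" by auto
      have "real c \<le> real r" using r(1) by (simp add: T2_def R_def)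
      also have "\<dots> \<le> 2 ^ r" using of_nat_less_two_power[of r] by (rule less_imp_le)
      finally have "2 / \<epsilon> \<le> 2 ^ r" using c by linarith
      then show "component_prob \<nu> k (eps_atomic \<epsilon>) > 1 - \<epsilon>"
        unfolding r(2) using assms fin r(1)
        by (intro N.component_prob_atomic) (auto simp: T2_def R_def q_def a_def not_le)
    qed
  qed
qed

end
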